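(* Let $\gamma=3$ and let $0<r_0<r_1$ be arbitrary. Let $w_0\in C^\infty(\mathbb T)$ satisfy $w_0\ge\nu_0>0$ and consider the initial data $u_r=0$, $u_\theta=\rho=\frac12 r w_0(\theta)$ at time $t=0$ in the annulus $A_{r_0,r_1}$. Suppose that $\|w_0\|_{L^\infty}\le1$, that there is a single point $\theta_0\in\mathbb T$ such that $\partial_\theta w_0(\theta_0)=\min_{\theta\in\mathbb T}\partial_\theta w_0(\theta)$, and that $$\partial_\theta w_0(\theta_0)=-\frac1\varepsilon$$ for some $\varepsilon>0$. Then the solution $w$ of the Burgers equation $$\partial_tw+w\,\partial_\theta w=0,\qquad w(\theta,0)=w_0(\theta),\qquad\theta\in\mathbb T,$$ develops a singularity at time $T_*=\varepsilon$ and angle $\theta_*=\theta_0+\varepsilon w_0(\theta_0)$. Moreover, the functions $$u_r=0,\qquad u_\theta=\tfrac12 r\,w(\theta,t),\qquad\rho=\tfrac12 r\,w(\theta,t)$$ form the unique smooth solution of the initial value problem for the Euler system (given in the context) in the domain $A_{r_0,r_1}$, with no-flux boundary conditions $u_r|_{r=r_0}=u_r|_{r=r_1}=0$, on the time interval $[0,\varepsilon)$. This solution satisfies $$\sup_{t\in[0,T_* )}\left(\|\rho(\cdot,t)\|_{L^\infty(A_{r_0,r_1})}+\|u(\cdot,t)\|_{L^\infty(A_{r_0,r_1})}\right)\le2r_1,$$ $$\sup_{t\in[0,T_* )}\left(\|\partial_r\rho(\cdot,t)\|_{L^\infty(A_{r_0,r_1})}+\|\partial_ru(\cdot,t)\|_{L^\infty(A_{r_0,r_1})}\right)\le2,$$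 $$\lim_{t\to T_*}\partial_\theta\rho(r,\theta_*,t)=\lim_{t\to T_*}\partial_\theta u_\theta(r,\theta_*,t)=-\infty\qquad\text{for each } r\in(r_0,r_1).$$ The vorticity $\omega=\frac1r\partial_r(ru_\theta)-\frac1r\partial_\theta u_r$ and the density satisfy $$\nu_0\le\omega(\theta,t)\le1,\qquad\rho(r,\theta,t)\ge r_0\frac{\nu_0}2$$ for all $r\in(r_0,r_1)$, $\theta\in\mathbb T$ and $t\in[0,\varepsilon)$.
   Context: $\mathbb T=[-\pi,\pi]$ with periodic boundary conditions (angles are taken modulo $2\pi$); $A_{r_0,r_1}=\{(r,\theta):r_0<r<r_1,\ \theta\in\mathbb T\}$ in polar coordinates. The Euler system is the 2D isentropic compressible Euler system with pressure $p(\rho)=\frac1\gamma\rho^\gamma$, in polar coordinates, for velocity $u=(u_r,u_\theta)$ and density $\rho>0$: $$\left(\partial_t+u_r\partial_r+\tfrac1ru_\theta\partial_\theta\right)u_r-\tfrac1ru_\theta^2+\rho^{\gamma-2}\partial_r\rho=0,$$ $$\left(\partial_t+u_r\partial_r+\tfrac1ru_\theta\partial_\theta\right)u_\theta+\tfrac1ru_ru_\theta+\tfrac1r\rho^{\gamma-2}\partial_\theta\rho=0,$$ $$\left(\partial_t+u_r\partial_r+\tfrac1ru_\theta\partial_\theta\right)\rho+\rho\left(\tfrac1ru_r+\partial_ru_r+\tfrac1r\partial_\theta u_\theta\right)=0,$$ here with $\gamma=3$. "$w$ develops a singularity at time $T_*$ and angle $\theta_*$" means that $w$ is smooth on $\mathbb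 T\times[0,T_* )$ and $\partial_\theta w(\theta_*,t)\to-\infty$ as $t\to T_*$. *)

theory Defs
  imports "HOL-Probability.Essential_Supremum" "HOL-Library.Real_Mod"
begin

text \<open>
  Functions on the circle are functions of a real angle with period \<open>2 * pi\<close>; equality of
  angles is \<open>rcong\<close> modulo \<open>2 * pi\<close>. Fields on an annulus are functions of \<open>r\<close>, \<open>\<theta>\<close>, \<open>t\<close>, in
  this order.
\<close>

definition periodic :: "(real \<Rightarrow> 'a) \<Rightarrow> bool" where
  "periodic f \<longleftrightarrow> (\<forall>\<theta>. f (\<theta> + 2 * pi) = f \<theta>)"

text \<open>
  Below, \<open>S\<close> is always convex with nonempty interior, so derivatives within \<open>S\<close> are unique and
  smoothness on \<open>S\<close> means that all partial derivatives exist in the interior and extend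
  continuously to \<open>S\<close>.
\<close>

primrec Ck_on :: "nat \<Rightarrow> ('a::euclidean_space \<Rightarrow> real) \<Rightarrow> 'a set \<Rightarrow> bool" where
  "Ck_on 0 f S \<longleftrightarrow> continuous_on S f"
| "Ck_on (Suc k) f S \<longleftrightarrow>
     (\<exists>f'. (\<forall>x\<in>S. (f has_derivative f' x) (at x within S)) \<and>
           (\<forall>v. Ck_on k (\<lambda>x. f' x v) S))"

definition smooth_on :: "('a::euclidean_space \<Rightarrow> real) \<Rightarrow> 'a set \<Rightarrow> bool" where
  "smooth_on f S \<longleftrightarrow> (\<forall>k. Ck_on k f S)"

definition Linf_norm :: "'a::euclidean_space set \<Rightarrow> ('a \<Rightarrow> 'b::real_normed_vector) \<Rightarrow> ereal" where
  "Linf_norm S f = esssup (restrict_space lborel S) (\<lambda>x. ereal (norm (f x)))"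

text \<open>
  The area measure \<open>r dr d\<theta>\<close> and the measure \<open>dr d\<theta>\<close> have the same null sets on the annulus,
  so \<open>Linf_norm\<close> may be taken in the \<open>(r, \<theta>)\<close> coordinates.
\<close>

definition annulus :: "real \<Rightarrow> real \<Rightarrow> (real \<times> real) set" where
  "annulus r0 r1 = {r0<..<r1} \<times> {-pi..pi}"

type_synonym field = "real \<Rightarrow> real \<Rightarrow> real \<Rightarrow> real"

definition d_r :: "field \<Rightarrow> field" where
  "d_r f r \<theta> t = deriv (\<lambda>s. f s \<theta> t) r"

definition d_theta :: "field \<Rightarrow> field" where
  "d_theta f r \<theta> t = deriv (\<lambda>\<phi>. f r \<phi> t) \<theta>"

text \<open>The time derivative is one-sided at \<open>t = 0\<close>, and two-sided for \<open>t > 0\<close>.\<close>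

definition time_deriv :: "(real \<Rightarrow> real) \<Rightarrow> real \<Rightarrow> real" where
  "time_deriv g t = vector_derivative g (at t within {0..})"

definition d_t :: "field \<Rightarrow> field" where
  "d_t f r \<theta> t = time_deriv (\<lambda>s. f r \<theta> s) t"

definition burgers_solution :: "(real \<Rightarrow> real) \<Rightarrow> real \<Rightarrow> (real \<Rightarrow> real \<Rightarrow> real) \<Rightarrow> bool" where
  "burgers_solution w0 T w \<longleftrightarrow>
     Ck_on 1 (\<lambda>(\<theta>, t). w \<theta> t) (UNIV \<times> {0..<T}) \<and>
     (\<forall>t\<in>{0..<T}. periodic (\<lambda>\<theta>. w \<theta> t)) \<and>
     (\<forall>\<theta>. w \<theta> 0 = w0 \<theta>) \<and>
     (\<forall>\<theta>. \<forall>t\<in>{0..<T}. time_deriv (\<lambda>s. w \<theta> s) t + w \<theta> t * deriv (\<lambda>\<phi>. w \<phi> t) \<theta> = 0)"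

definition develops_singularity :: "(real \<Rightarrow> real \<Rightarrow> real) \<Rightarrow> real \<Rightarrow> real \<Rightarrow> bool" where
  "develops_singularity w T \<theta>s \<longleftrightarrow>
     smooth_on (\<lambda>(\<theta>, t). w \<theta> t) (UNIV \<times> {0..<T}) \<and>
     (\<forall>t\<in>{0..<T}. periodic (\<lambda>\<theta>. w \<theta> t)) \<and>
     filterlim (\<lambda>t. deriv (\<lambda>\<theta>. w \<theta> t) \<theta>s) at_bot (at_left T)"

definition material_deriv :: "field \<Rightarrow> field \<Rightarrow> field \<Rightarrow> field" where
  "material_deriv ur ut f r \<theta> t =
     d_t f r \<theta> t + ur r \<theta> t * d_r f r \<theta> t + 1 / r * ut r \<theta> t * d_theta f r \<theta> t"

definition euler_equations_at :: "real \<Rightarrow> field \<Rightarrow> field \<Rightarrow> field \<Rightarrow> real \<Rightarrow> real \<Rightarrow> real \<Rightarrow> bool" where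
  "euler_equations_at \<gamma> ur ut \<rho> r \<theta> t \<longleftrightarrow>
     material_deriv ur ut ur r \<theta> t - 1 / r * (ut r \<theta> t)\<^sup>2
       + \<rho> r \<theta> t powr (\<gamma> - 2) * d_r \<rho> r \<theta> t = 0 \<and>
     material_deriv ur ut ut r \<theta> t + 1 / r * ur r \<theta> t * ut r \<theta> t
       + 1 / r * \<rho> r \<theta> t powr (\<gamma> - 2) * d_theta \<rho> r \<theta> t = 0 \<and>
     material_deriv ur ut \<rho> r \<theta> t
       + \<rho> r \<theta> t * (1 / r * ur r \<theta> t + d_r ur r \<theta> t + 1 / r * d_theta ut r \<theta> t) = 0"

definition smooth_field :: "real \<Rightarrow> real \<Rightarrow> real \<Rightarrow> field \<Rightarrow> bool" where
  "smooth_field r0 r1 T f \<longleftrightarrow>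
     smooth_on (\<lambda>(r, \<theta>, t). f r \<theta> t) ({r0..r1} \<times> UNIV \<times> {0..<T}) \<and>
     (\<forall>r\<in>{r0..r1}. \<forall>t\<in>{0..<T}. periodic (\<lambda>\<theta>. f r \<theta> t))"

text \<open>
  Smooth solutions are smooth up to the boundary circles, so that the no-flux condition is
  meaningful; the equations and \<open>\<rho> > 0\<close> are required in the open annulus.
\<close>

definition euler_solution ::
    "real \<Rightarrow> real \<Rightarrow> real \<Rightarrow> real \<Rightarrow>
     (real \<Rightarrow> real \<Rightarrow> real) \<Rightarrow> (real \<Rightarrow> real \<Rightarrow> real) \<Rightarrow> (real \<Rightarrow> real \<Rightarrow> real) \<Rightarrow>
     field \<Rightarrow> field \<Rightarrow> field \<Rightarrow> bool" where
  "euler_solution \<gamma> r0 r1 T ur0 ut0 \<rho>0 ur ut \<rho> \<longleftrightarrow>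
     smooth_field r0 r1 T ur \<and> smooth_field r0 r1 T ut \<and> smooth_field r0 r1 T \<rho> \<and>
     (\<forall>r\<in>{r0<..<r1}. \<forall>\<theta>. \<forall>t\<in>{0..<T}. \<rho> r \<theta> t > 0 \<and> euler_equations_at \<gamma> ur ut \<rho> r \<theta> t) \<and>
     (\<forall>\<theta>. \<forall>t\<in>{0..<T}. ur r0 \<theta> t = 0 \<and> ur r1 \<theta> t = 0) \<and>
     (\<forall>r\<in>{r0<..<r1}. \<forall>\<theta>. ur r \<theta> 0 = ur0 r \<theta> \<and> ut r \<theta> 0 = ut0 r \<theta> \<and> \<rho> r \<theta> 0 = \<rho>0 r \<theta>)"

definition vorticity :: "field \<Rightarrow> field \<Rightarrow> field" where
  "vorticity ur ut r \<theta> t =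
     1 / r * d_r (\<lambda>s \<phi> \<tau>. s * ut s \<phi> \<tau>) r \<theta> t - 1 / r * d_theta ur r \<theta> t"

end

theory Submission
  imports Defs
begin

text \<open>
  With \<open>u\<^sub>r = 0\<close> and \<open>u\<^sub>\<theta> = \<rho> = r w / 2\<close> the first Euler equation holds identically for
  \<open>\<gamma> = 3\<close>, and the other two both become Burgers' equation for \<open>w\<close>. The latter is solved by
  characteristics: \<open>w(\<theta>, t) = w\<^sub>0(Y)\<close>, where \<open>Y\<close> is determined by \<open>Y + t w\<^sub>0(Y) = \<theta>\<close>, and
  \<open>\<partial>\<^sub>\<theta>w = w\<^sub>0'(Y) / (1 + t w\<^sub>0'(Y))\<close>. At \<open>\<theta>\<^sub>*\<close> the foot \<open>Y\<close> tends to \<open>\<theta>\<^sub>0\<close> as \<open>t\<close> tends to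
  \<open>\<epsilon>\<close>, because \<open>\<theta>\<^sub>0\<close> is an isolated minimum of \<open>w\<^sub>0'\<close>, so the denominator vanishes in the limit.
  Uniqueness for the Euler system is the energy method: no flux crosses the boundary since
  \<open>u\<^sub>r\<close> vanishes there for both solutions.
\<close>

section \<open>Functions of class \<open>C\<^sup>k\<close>\<close>

text \<open>The slope bound on \<open>w0\<close> enters in quantitative form: the flow map
  \<open>y + t * w0 y\<close> stretches distances by at least \<open>1 - t / \<epsilon>\<close>.
  This gives existence, uniqueness and continuity of the foot before the critical time; smoothness
  follows because the derivative of the foot is an expression in the foot itself. For the Euler
  system, \<gamma> = 3 is the case in which the sound speed
  \<open>\<rho> powr ((\<gamma> - 1) / 2)\<close> equals the density. The pressure terms of the
  momentum equations and the compression terms of the density equation then carry the same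
  coefficient \<rho>, so the plain sum of squares of the differences serves as energy, without
  weights. Two obstacles shape the estimate: the equations are given in the open annulus only,
  whereas the flux has to be evaluated on the boundary circles; and first derivatives are controlled
  only on compact time intervals, so the estimate runs over \<open>{0..t}\<close> with
  \<open>t < T\<close>.\<close>

lemma Ck_on_SucI:
  assumes "\<And>x. x \<in> S \<Longrightarrow> (f has_derivative f' x) (at x within S)"
    and "\<And>v. Ck_on k (\<lambda>x. f' x v) S"
  shows "Ck_on (Suc k) f S"
  using assms by auto

lemma Ck_on_SucD: "Ck_on (Suc k) f S \<Longrightarrow> Ck_on k f S"
proof (induction k arbitrary: f)
  case 0
  then obtain f' where "\<And>x. x \<in> S \<Longrightarrow> (f has_derivative f' x) (at x within S)" by auto
  then show ?case using has_derivative_continuous_on[of S f f'] by simp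
next
  case (Suc k)
  then show ?case by (metis Ck_on.simps(2))
qed

lemma Ck_on_continuous: "Ck_on k f S \<Longrightarrow> continuous_on S f"
  by (induction k) (auto dest: Ck_on_SucD simp del: Ck_on.simps(2))

lemma Ck_on_const: "Ck_on k (\<lambda>x. c) S"
proof (induction k arbitrary: c)
  case (Suc k)
  show ?case by (rule Ck_on_SucI[where f' = "\<lambda>x v. 0"]) (simp_all add: Suc)
qed auto

lemma Ck_on_bounded_linear:
  assumes "bounded_linear L"
  shows "Ck_on k L S"
proof (cases k)
  case 0
  then show ?thesis
    using assms by (auto intro: linear_continuous_on)
next
  case (Suc l)
  show ?thesis unfolding Suc
    by (rule Ck_on_SucI[where f' = "\<lambda>x. L"])
      (auto intro: bounded_linear_imp_has_derivative assms Ck_on_const)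
qed

lemma Ck_on_add:
  "Ck_on k f S \<Longrightarrow> Ck_on k g S \<Longrightarrow> Ck_on k (\<lambda>x. f x + g x) S"
proof (induction k arbitrary: f g)
  case 0
  then show ?case by (simp add: continuous_on_add)
next
  case (Suc k)
  from Suc.prems obtain f' g' where
    "\<forall>x\<in>S. (f has_derivative f' x) (at x within S)" "\<forall>v. Ck_on k (\<lambda>x. f' x v) S"
    "\<forall>x\<in>S. (g has_derivative g' x) (at x within S)" "\<forall>v. Ck_on k (\<lambda>x. g' x v) S"
    by auto
  then show ?case
    by (intro Ck_on_SucI[where f' = "\<lambda>x v. f' x v + g' x v"])
      (auto intro!: has_derivative_add intro: Suc.IH simp del: Ck_on.simps)
qed

lemma Ck_on_mult:
  "Ck_on k f S \<Longrightarrow> Ck_on k g S \<Longrightarrow> Ck_on k (\<lambda>x. f x * g x) S"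
proof (induction k arbitrary: f g)
  case 0
  then show ?case by (simp add: continuous_on_mult)
next
  case (Suc k)
  from Suc.prems obtain f' g' where
    "\<forall>x\<in>S. (f has_derivative f' x) (at x within S)" "\<forall>v. Ck_on k (\<lambda>x. f' x v) S"
    "\<forall>x\<in>S. (g has_derivative g' x) (at x within S)" "\<forall>v. Ck_on k (\<lambda>x. g' x v) S"
    by auto
  then show ?case
    using Suc.prems[THEN Ck_on_SucD]
    by (intro Ck_on_SucI[where f' = "\<lambda>x v. f x * g' x v + f' x v * g x"])
      (auto intro!: has_derivative_mult intro: Ck_on_add[OF Suc.IH Suc.IH] simp del: Ck_on.simps)
qed

lemma Ck_on_uminus: "Ck_on k f S \<Longrightarrow> Ck_on k (\<lambda>x. - f x) S"
  using Ck_on_mult[OF Ck_on_const[of k "-1"]] by simp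

lemma Ck_on_inverse:
  "Ck_on k f S \<Longrightarrow> (\<And>x. x \<in> S \<Longrightarrow> f x \<noteq> 0) \<Longrightarrow> Ck_on k (\<lambda>x. inverse (f x)) S"
proof (induction k)
  case 0
  then show ?case by (simp add: continuous_on_inverse)
next
  case (Suc k)
  from Suc.prems obtain f' where
    "\<forall>x\<in>S. (f has_derivative f' x) (at x within S)" "\<forall>v. Ck_on k (\<lambda>x. f' x v) S"
    by auto
  then show ?case
    using Suc Suc.prems(1)[THEN Ck_on_SucD]
    by (intro Ck_on_SucI[where f' = "\<lambda>x v. - (inverse (f x) * f' x v * inverse (f x))"])
      (auto intro!: has_derivative_inverse intro: Ck_on_uminus[OF Ck_on_mult[OF Ck_on_mult]]
        simp del: Ck_on.simps)
qed

lemma Ck_on_compose: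
  fixes \<phi> :: "real \<Rightarrow> real"
  shows "Ck_on k \<phi> T \<Longrightarrow> Ck_on k g S \<Longrightarrow> g ` S \<subseteq> T \<Longrightarrow> Ck_on k (\<lambda>x. \<phi> (g x)) S"
proof (induction k arbitrary: \<phi>)
  case 0
  then show ?case by (auto intro: continuous_on_compose2)
next
  case (Suc k)
  from Suc.prems obtain \<phi>' g' where
    \<phi>: "\<forall>x\<in>T. (\<phi> has_derivative \<phi>' x) (at x within T)" "\<forall>v. Ck_on k (\<lambda>x. \<phi>' x v) T" and
    g: "\<forall>x\<in>S. (g has_derivative g' x) (at x within S)" "\<forall>v. Ck_on k (\<lambda>x. g' x v) S"
    by auto
  show ?case
  \<comment> \<open>The chain rule gives \<open>\<phi>' (g x) (g' x v)\<close>, whose direction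
    moves with \<open>x\<close>, while \<open>Ck_on\<close> speaks of fixed directions. A linear map
    on the reals is multiplication by its value at \<open>1\<close>, which leaves only the direction
    \<open>1\<close> to be composed with \<open>g\<close>.\<close>
  proof (rule Ck_on_SucI[where f' = "\<lambda>x v. g' x v * \<phi>' (g x) 1"])
    show "((\<lambda>x. \<phi> (g x)) has_derivative (\<lambda>v. g' x v * \<phi>' (g x) 1)) (at x within S)"
      if "x \<in> S" for x
    proof -
      have lin: "linear (\<phi>' (g x))"
        using \<phi>(1) Suc.prems(3) that has_derivative_linear by blast
      have "\<phi>' (g x) (g' x v) = g' x v * \<phi>' (g x) 1" for v
        using linear_cmul[OF lin, of "g' x v" 1] by simp
      moreover have "((\<lambda>x. \<phi> (g x)) has_derivative (\<lambda>v. \<phi>' (g x) (g' x v))) (at x within S)"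
        using \<phi>(1) g(1) Suc.prems(3) that
        by (intro has_derivative_in_compose2[of T \<phi> \<phi>' g S x "g' x"]) simp_all
      ultimately show ?thesis by simp
    qed
    show "Ck_on k (\<lambda>x. g' x v * \<phi>' (g x) 1) S" for v
      using g(2) \<phi>(2) Suc.IH[OF _ Ck_on_SucD[OF Suc.prems(2)] Suc.prems(3)]
      by (intro Ck_on_mult) auto
  qed
qed

text \<open>Here the outer function may have several variables: a linear inner map has a constant
  derivative, so the direction \<open>L v\<close> does not depend on the point and the induction
  hypothesis applies to it directly.\<close>

lemma Ck_on_compose_linear:
  assumes "bounded_linear L" "L ` S \<subseteq> T"
  shows "Ck_on k f T \<Longrightarrow> Ck_on k (\<lambda>x. f (L x)) S"
proof (induction k arbitrary: f)
  case 0
  then show ?case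
    using assms by (auto intro: continuous_on_compose2 linear_continuous_on)
next
  case (Suc k)
  from Suc.prems obtain f' where
    "\<forall>x\<in>T. (f has_derivative f' x) (at x within T)" "\<forall>v. Ck_on k (\<lambda>x. f' x v) T"
    by auto
  note f' = this
  show ?case
  proof (rule Ck_on_SucI[where f' = "\<lambda>x v. f' (L x) (L v)"])
    show "((\<lambda>x. f (L x)) has_derivative (\<lambda>v. f' (L x) (L v))) (at x within S)" if "x \<in> S" for x
      using f'(1) that assms
      by (intro has_derivative_in_compose2[of T f f' L S x L] bounded_linear_imp_has_derivative) auto
    show "Ck_on k (\<lambda>x. f' (L x) (L v)) S" for v
      using Suc.IH f'(2) by blast
  qed
qed

lemma smooth_on_deriv:
  fixes f :: "real \<Rightarrow> real"
  assumes "smooth_on f UNIV"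
  shows "(f has_real_derivative deriv f x) (at x)" "Ck_on k (deriv f) UNIV"
proof -
  have "Ck_on (Suc k) f UNIV" using assms unfolding smooth_on_def by blast
  then obtain f' where f': "\<forall>x. (f has_derivative f' x) (at x)" "\<forall>v. Ck_on k (\<lambda>x. f' x v) UNIV"
    by auto
  have "(f has_real_derivative f' x 1) (at x)" for x
  proof -
    have "linear (f' x)" using f'(1) has_derivative_linear by blast
    then have "f' x = (*) (f' x 1)"
    proof (intro ext)
      fix v
      show "f' x v = f' x 1 * v"
        using linear_cmul[OF \<open>linear (f' x)\<close>, of v 1] by simp
    qed
    then show ?thesis
      using f'(1) unfolding has_field_derivative_def by simp
  qed
  note D = this
  show "(f has_real_derivative deriv f x) (at x)"
    using D[of x] by (simp add: DERIV_imp_deriv)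
  have "deriv f = (\<lambda>x. f' x 1)"
    using D DERIV_imp_deriv by blast
  then show "Ck_on k (deriv f) UNIV"
    using f'(2) by simp
qed

section \<open>Energy estimates\<close>

text \<open>The integrating factor \<open>exp (- C * t)\<close> turns the inequality into
  monotonicity. At the two endpoints the derivative is one-sided, so its sign is used in the open
  interval only and continuity covers the ends.\<close>

lemma gronwall_nonpos:
  fixes E E' :: "real \<Rightarrow> real"
  assumes "0 \<le> \<tau>"
    and D: "\<And>t. t \<in> {0..\<tau>} \<Longrightarrow> (E has_real_derivative E' t) (at t within {0..\<tau>})"
    and le: "\<And>t. t \<in> {0..\<tau>} \<Longrightarrow> E' t \<le> C * E t"
    and "E 0 \<le> 0"
  shows "E \<tau> \<le> 0"
proof -
  let ?G = "\<lambda>t. exp (- C * t) * E t"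
  have "?G \<tau> \<le> ?G 0"
  proof (rule DERIV_nonpos_imp_decreasing_open[OF \<open>0 \<le> \<tau>\<close>])
    fix t assume t: "0 < t" "t < \<tau>"
    have "(E has_real_derivative E' t) (at t)"
      using D[of t] t at_within_Icc_at[of 0 t \<tau>] by simp
    then have "(?G has_real_derivative exp (- C * t) * (E' t - C * E t)) (at t)"
      by (auto intro!: derivative_eq_intros simp: algebra_simps)
    moreover have "exp (- C * t) * (E' t - C * E t) \<le> 0"
      using le[of t] t by (intro mult_nonneg_nonpos) auto
    ultimately show "\<exists>y. (?G has_real_derivative y) (at t) \<and> y \<le> 0" by blast
  next
    have "continuous_on {0..\<tau>} E"
      using D by (rule DERIV_continuous_on)
    then show "continuous_on {0..\<tau>} ?G" by (intro continuous_intros)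
  qed
  with \<open>E 0 \<le> 0\<close> have "exp (- C * \<tau>) * E \<tau> \<le> 0" by simp
  then show ?thesis by (simp add: mult_le_0_iff)
qed

text \<open>Integrated over the rectangle, the flux terms drop out: \<open>P\<close> agrees on the
  two boundary circles and \<open>Q\<close> agrees at the two ends of the angular interval. The
  total energy thus satisfies a Gronwall inequality with zero initial value.\<close>

lemma energy_zero:
  fixes e et P Pr Q Q\<theta> :: "real \<Rightarrow> real \<Rightarrow> real \<Rightarrow> real"
  defines "D \<equiv> \<lambda>r0 r1 \<alpha> \<beta> \<tau>. {r0..r1} \<times> {\<alpha>..\<beta>} \<times> {0..\<tau>::real}"
  assumes "r0 < r1" "\<alpha> < \<beta>" "0 \<le> \<tau>"
    and ce: "continuous_on (D r0 r1 \<alpha> \<beta> \<tau>) (\<lambda>(r, \<theta>, t). e r \<theta> t)"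
    and cet: "continuous_on (D r0 r1 \<alpha> \<beta> \<tau>) (\<lambda>(r, \<theta>, t). et r \<theta> t)"
    and cP: "continuous_on (D r0 r1 \<alpha> \<beta> \<tau>) (\<lambda>(r, \<theta>, t). Pr r \<theta> t)"
    and cQ: "continuous_on (D r0 r1 \<alpha> \<beta> \<tau>) (\<lambda>(r, \<theta>, t). Q\<theta> r \<theta> t)"
    and De: "\<And>r \<theta> t. (r, \<theta>, t) \<in> D r0 r1 \<alpha> \<beta> \<tau> \<Longrightarrow>
      ((\<lambda>s. e r \<theta> s) has_real_derivative et r \<theta> t) (at t within {0..\<tau>})"
    and DP: "\<And>r \<theta> t. (r, \<theta>, t) \<in> D r0 r1 \<alpha> \<beta> \<tau> \<Longrightarrow>
      ((\<lambda>s. P s \<theta> t) has_real_derivative Pr r \<theta> t) (at r within {r0..r1})"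
    and DQ: "\<And>r \<theta> t. (r, \<theta>, t) \<in> D r0 r1 \<alpha> \<beta> \<tau> \<Longrightarrow>
      ((\<lambda>s. Q r s t) has_real_derivative Q\<theta> r \<theta> t) (at \<theta> within {\<alpha>..\<beta>})"
    and P0: "\<And>\<theta> t. \<theta> \<in> {\<alpha>..\<beta>} \<Longrightarrow> t \<in> {0..\<tau>} \<Longrightarrow> P r0 \<theta> t = P r1 \<theta> t"
    and Q0: "\<And>r t. r \<in> {r0..r1} \<Longrightarrow> t \<in> {0..\<tau>} \<Longrightarrow> Q r \<alpha> t = Q r \<beta> t"
    and le: "\<And>r \<theta> t. (r, \<theta>, t) \<in> D r0 r1 \<alpha> \<beta> \<tau> \<Longrightarrow>
      et r \<theta> t + Pr r \<theta> t + Q\<theta> r \<theta> t \<le> C * e r \<theta> t"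
    and nonneg: "\<And>r \<theta> t. (r, \<theta>, t) \<in> D r0 r1 \<alpha> \<beta> \<tau> \<Longrightarrow> 0 \<le> e r \<theta> t"
    and init: "\<And>r \<theta>. r \<in> {r0..r1} \<Longrightarrow> \<theta> \<in> {\<alpha>..\<beta>} \<Longrightarrow> e r \<theta> 0 = 0"
    and "r \<in> {r0..r1}" "\<theta> \<in> {\<alpha>..\<beta>}"
  shows "e r \<theta> \<tau> = 0"
proof -
  let ?B = "cbox (r0, \<alpha>) (r1, \<beta>)"
  have B: "?B = {r0..r1} \<times> {\<alpha>..\<beta>}"
    by (simp add: cbox_Pair_eq)
  have slice: "continuous_on ?B (\<lambda>(r, \<theta>). f r \<theta> t)"
    if "continuous_on (D r0 r1 \<alpha> \<beta> \<tau>) (\<lambda>(r, \<theta>, t). f r \<theta> t)" "t \<in> {0..\<tau>}"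
    for f :: "real \<Rightarrow> real \<Rightarrow> real \<Rightarrow> real" and t
  proof -
    have "continuous_on ?B (\<lambda>x. (\<lambda>(r, \<theta>, t). f r \<theta> t) (fst x, snd x, t))"
      by (rule continuous_on_compose2[OF that(1)])
        (use that(2) in \<open>auto simp: B D_def intro!: continuous_intros\<close>)
    then show ?thesis by (simp add: case_prod_unfold)
  qed
  note int = integrable_continuous[OF slice]
  define E where "E t = integral ?B (\<lambda>(r, \<theta>). e r \<theta> t)" for t
  have DE: "(E has_real_derivative integral ?B (\<lambda>(r, \<theta>). et r \<theta> t)) (at t within {0..\<tau>})"
    if "t \<in> {0..\<tau>}" for t
    unfolding E_def
  proof (rule leibniz_rule_field_derivative)
    show "continuous_on ({0..\<tau>} \<times> ?B) (\<lambda>(t, x). (\<lambda>(r, \<theta>). et r \<theta> t) x)"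
    proof -
      have "continuous_on ({0..\<tau>} \<times> ?B)
          (\<lambda>x. (\<lambda>(r, \<theta>, t). et r \<theta> t) (fst (snd x), snd (snd x), fst x))"
        by (rule continuous_on_compose2[OF cet]) (auto simp: B D_def intro!: continuous_intros)
      then show ?thesis by (simp add: case_prod_unfold)
    qed
  qed (use that int[OF ce] in \<open>auto simp: B D_def intro!: De\<close>)
  have E0: "E 0 = 0"
  proof -
    have "E 0 = integral ?B (\<lambda>x. 0)"
      unfolding E_def by (rule integral_cong) (auto simp: B init)
    then show ?thesis by simp
  qed
  have intP: "integral ?B (\<lambda>(r, \<theta>). Pr r \<theta> t) = 0" if t: "t \<in> {0..\<tau>}" for t
  proof -
    have "integral ?B (\<lambda>(r, \<theta>). Pr r \<theta> t) =
        integral (cbox \<alpha> \<beta>) (\<lambda>\<theta>. integral (cbox r0 r1) (\<lambda>r. Pr r \<theta> t))"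
      using integral_prod_continuous[OF slice[OF cP t]] integral_swap_continuous[OF slice[OF cP t]]
      by simp
    also have "\<dots> = integral (cbox \<alpha> \<beta>) (\<lambda>\<theta>. 0)"
    proof (rule integral_cong)
      fix \<theta> assume \<theta>: "\<theta> \<in> cbox \<alpha> \<beta>"
      have "((\<lambda>r. Pr r \<theta> t) has_integral P r1 \<theta> t - P r0 \<theta> t) {r0..r1}"
        using \<open>r0 < r1\<close> \<theta> t
        by (intro fundamental_theorem_of_calculus)
          (auto simp: D_def has_real_derivative_iff_has_vector_derivative[symmetric] intro!: DP)
      then show "integral (cbox r0 r1) (\<lambda>r. Pr r \<theta> t) = 0"
        using P0[of \<theta> t] \<theta> t by (simp add: integral_unique)
    qed
    finally show ?thesis by simp
  qed
  have intQ: "integral ?B (\<lambda>(r, \<theta>). Q\<theta> r \<theta> t) = 0" if t: "t \<in> {0..\<tau>}" for t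
  proof -
    have "integral ?B (\<lambda>(r, \<theta>). Q\<theta> r \<theta> t) =
        integral (cbox r0 r1) (\<lambda>r. integral (cbox \<alpha> \<beta>) (\<lambda>\<theta>. Q\<theta> r \<theta> t))"
      using integral_prod_continuous[OF slice[OF cQ t]] by simp
    also have "\<dots> = integral (cbox r0 r1) (\<lambda>r. 0)"
    proof (rule integral_cong)
      fix r assume r: "r \<in> cbox r0 r1"
      have "((\<lambda>\<theta>. Q\<theta> r \<theta> t) has_integral Q r \<beta> t - Q r \<alpha> t) {\<alpha>..\<beta>}"
        using \<open>\<alpha> < \<beta>\<close> r t
        by (intro fundamental_theorem_of_calculus)
          (auto simp: D_def has_real_derivative_iff_has_vector_derivative[symmetric] intro!: DQ)
      then show "integral (cbox \<alpha> \<beta>) (\<lambda>\<theta>. Q\<theta> r \<theta> t) = 0"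
        using Q0[of r t] r t by (simp add: integral_unique)
    qed
    finally show ?thesis by simp
  qed
  have "E \<tau> \<le> 0"
  proof (rule gronwall_nonpos[OF \<open>0 \<le> \<tau>\<close> DE])
    fix t assume t: "t \<in> {0..\<tau>}"
    have intCe: "(\<lambda>x. C * (case x of (r, \<theta>) \<Rightarrow> e r \<theta> t)) integrable_on ?B"
      using integrable_on_cmult_left[OF int[OF ce t], of C] by simp
    \<comment> \<open>The two flux integrals are zero; adding them produces the integrand that
      \<open>le\<close> bounds pointwise.\<close>
    have "integral ?B (\<lambda>(r, \<theta>). et r \<theta> t) =
        integral ?B (\<lambda>(r, \<theta>). et r \<theta> t) + integral ?B (\<lambda>(r, \<theta>). Pr r \<theta> t)
          + integral ?B (\<lambda>(r, \<theta>). Q\<theta> r \<theta> t)"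
      using intP[OF t] intQ[OF t] by simp
    also have "\<dots> = integral ?B (\<lambda>x. (case x of (r, \<theta>) \<Rightarrow> et r \<theta> t) + (case x of (r, \<theta>) \<Rightarrow> Pr r \<theta> t)
          + (case x of (r, \<theta>) \<Rightarrow> Q\<theta> r \<theta> t))"
      using int[OF cet t] int[OF cP t] int[OF cQ t] by (simp add: integral_add integrable_add)
    also have "\<dots> \<le> integral ?B (\<lambda>x. C * (case x of (r, \<theta>) \<Rightarrow> e r \<theta> t))"
      using int[OF cet t] int[OF cP t] int[OF cQ t] int[OF ce t] t
      by (intro integral_le integrable_add intCe)
        (auto simp: B D_def intro!: le)
    also have "\<dots> = C * E t"
      unfolding E_def by simp
    finally show "integral ?B (\<lambda>(r, \<theta>). et r \<theta> t) \<le> C * E t" .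
  qed (use E0 in auto)
  moreover have "0 \<le> E \<tau>"
    unfolding E_def using \<open>0 \<le> \<tau>\<close>
    by (intro integral_nonneg int[OF ce]) (auto simp: B D_def intro!: nonneg)
  \<comment> \<open>A nonnegative continuous function with zero integral vanishes on the whole
    closed box, which gives the pointwise claim.\<close>
  ultimately have "((\<lambda>(r, \<theta>). e r \<theta> \<tau>) has_integral 0) ?B"
    using integrable_integral[OF int[OF ce, of \<tau>]] \<open>0 \<le> \<tau>\<close> unfolding E_def by simp
  then have "(\<lambda>(r, \<theta>). e r \<theta> \<tau>) (r, \<theta>) = 0"
  proof (rule has_integral_0_cbox_imp_0[OF slice[OF ce], rotated 2])
    show "box (r0, \<alpha>) (r1, \<beta>) \<noteq> {}"
      using \<open>r0 < r1\<close> \<open>\<alpha> < \<beta>\<close> by (auto simp: box_ne_empty Basis_prod_def)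
    show "0 \<le> (case x of (r, \<theta>) \<Rightarrow> e r \<theta> \<tau>)" if "x \<in> box (r0, \<alpha>) (r1, \<beta>)" for x
      using box_subset_cbox[of "(r0, \<alpha>)" "(r1, \<beta>)"] that \<open>0 \<le> \<tau>\<close>
      by (cases x) (auto simp: B D_def subset_iff intro!: nonneg)
  qed (use assms in \<open>auto simp: B\<close>)
  then show ?thesis by simp
qed

section \<open>Partial derivatives of smooth fields and the equations up to the boundary\<close>

lemma time_deriv_eq:
  assumes "(g has_real_derivative D) (at t within {0..<T})" "t \<in> {0..<T}"
  shows "time_deriv g t = D"
proof -
  have "at t within {0..<T} = at t within {0..}"
    by (rule at_within_nhd[of t "{..<T}"]) (use assms(2) in auto)
  then have "(g has_vector_derivative D) (at t within {0..})"
    using assms(1) by (simp add: has_real_derivative_iff_has_vector_derivative)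
  moreover have "at t within {0..} \<noteq> bot"
  proof -
    have "at_right t \<le> at t within {0..}"
      using assms(2) by (intro at_le) auto
    then show ?thesis
      by (metis bot_unique trivial_limit_at_right_real)
  qed
  ultimately show ?thesis
    unfolding time_deriv_def by (intro vector_derivative_within)
qed

text \<open>The derivative in \<open>r\<close> is taken within the closed interval and the one in
  \<open>t\<close> within \<open>{0..<T}\<close>, so that the boundary circles and the initial time
  are included. This is the form that the integration of the fluxes and the time derivative of the
  energy require.\<close>

definition has_partials ::
    "real \<Rightarrow> real \<Rightarrow> real \<Rightarrow> field \<Rightarrow> field \<Rightarrow> field \<Rightarrow> field \<Rightarrow> bool" where
  "has_partials r0 r1 T f fr f\<theta> ft \<longleftrightarrow>
     (\<forall>g\<in>{f, fr, f\<theta>, ft}. continuous_on ({r0..r1} \<times> UNIV \<times> {0..<T}) (\<lambda>(r, \<theta>, t). g r \<theta> t)) \<and>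
     (\<forall>r\<in>{r0..r1}. \<forall>\<theta>. \<forall>t\<in>{0..<T}.
        ((\<lambda>s. f s \<theta> t) has_real_derivative fr r \<theta> t) (at r within {r0..r1}) \<and>
        ((\<lambda>s. f r s t) has_real_derivative f\<theta> r \<theta> t) (at \<theta>) \<and>
        ((\<lambda>s. f r \<theta> s) has_real_derivative ft r \<theta> t) (at t within {0..<T}))"

lemma has_partials_continuous:
  assumes "has_partials r0 r1 T f fr f\<theta> ft" "g \<in> {f, fr, f\<theta>, ft}"
  shows "continuous_on ({r0..r1} \<times> UNIV \<times> {0..<T}) (\<lambda>x. g (fst x) (fst (snd x)) (snd (snd x)))"
  using assms unfolding has_partials_def case_prod_unfold by blast

lemma has_partials_D:
  assumes "has_partials r0 r1 T f fr f\<theta> ft" "r \<in> {r0..r1}" "t \<in> {0..<T}"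
  shows "((\<lambda>s. f s \<theta> t) has_real_derivative fr r \<theta> t) (at r within {r0..r1})"
    and "((\<lambda>s. f r s t) has_real_derivative f\<theta> r \<theta> t) (at \<theta>)"
    and "((\<lambda>s. f r \<theta> s) has_real_derivative ft r \<theta> t) (at t within {0..<T})"
  using assms unfolding has_partials_def by blast+

lemma Ck_on_has_partials:
  assumes "Ck_on 1 (\<lambda>(r, \<theta>, t). f r \<theta> t) ({r0..r1} \<times> UNIV \<times> {0..<T})"
  obtains fr f\<theta> ft where "has_partials r0 r1 T f fr f\<theta> ft"
proof -
  let ?S = "{r0..r1} \<times> (UNIV :: real set) \<times> {0..<T}" and ?f = "\<lambda>(r, \<theta>, t). f r \<theta> t"
  obtain F where F: "\<And>x. x \<in> ?S \<Longrightarrow> (?f has_derivative F x) (at x within ?S)"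
      and cF: "\<And>v. continuous_on ?S (\<lambda>x. F x v)"
    using assms by auto
  \<comment> \<open>The chain rule along a curve with velocity \<open>v\<close>; the three
    coordinate lines through a point then give the three partial derivatives as values of the total
    derivative at the unit vectors.\<close>
  have slice: "((\<lambda>s. ?f (L s)) has_real_derivative F (L x) v) (at x within A)"
    if L: "(L has_derivative (\<lambda>h. h *\<^sub>R v)) (at x within A)" and "x \<in> A" "L ` A \<subseteq> ?S"
    for L :: "real \<Rightarrow> real \<times> real \<times> real" and x v A
  proof -
    have "L x \<in> ?S" using that by blast
    have "linear (F (L x))"
      using F[OF \<open>L x \<in> ?S\<close>] has_derivative_linear by blast
    then have "(\<lambda>h. F (L x) (h *\<^sub>R v)) = (*) (F (L x) v)"
      by (simp add: linear_cmul fun_eq_iff mult.commute)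
    moreover have "((\<lambda>s. ?f (L s)) has_derivative (\<lambda>h. F (L x) (h *\<^sub>R v))) (at x within A)"
      by (rule has_derivative_in_compose2[where t = ?S and f = L and g' = F])
        (use F that in auto)
    ultimately show ?thesis by (simp add: has_field_derivative_def)
  qed
  have "has_partials r0 r1 T f (\<lambda>r \<theta> t. F (r, \<theta>, t) (1, 0, 0)) (\<lambda>r \<theta> t. F (r, \<theta>, t) (0, 1, 0))
     (\<lambda>r \<theta> t. F (r, \<theta>, t) (0, 0, 1))"
    unfolding has_partials_def
  proof (intro conjI ballI allI)
    fix g assume "g \<in> {f, \<lambda>r \<theta> t. F (r, \<theta>, t) (1, 0, 0), \<lambda>r \<theta> t. F (r, \<theta>, t) (0, 1, 0),
      \<lambda>r \<theta> t. F (r, \<theta>, t) (0, 0, 1)}"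
    then show "continuous_on ?S (\<lambda>(r, \<theta>, t). g r \<theta> t)"
      using cF Ck_on_continuous[OF assms] by (auto simp: case_prod_unfold)
  next
    fix r \<theta> t :: real assume rt: "r \<in> {r0..r1}" "t \<in> {0..<T}"
    show "((\<lambda>s. f s \<theta> t) has_real_derivative F (r, \<theta>, t) (1, 0, 0)) (at r within {r0..r1})"
    proof -
      have "((\<lambda>s. (s, \<theta>, t)) has_derivative (\<lambda>h. (h, 0, 0))) (at r within {r0..r1})"
        by (intro has_derivative_Pair has_derivative_ident has_derivative_const)
      then show ?thesis
        using slice[of "\<lambda>s. (s, \<theta>, t)" "(1, 0, 0)" r "{r0..r1}"] rt by (simp add: image_subset_iff)
    qed
    show "((\<lambda>s. f r s t) has_real_derivative F (r, \<theta>, t) (0, 1, 0)) (at \<theta>)"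
    proof -
      have "((\<lambda>s. (r, s, t)) has_derivative (\<lambda>h. (0, h, 0))) (at \<theta> within UNIV)"
        by (intro has_derivative_Pair has_derivative_ident has_derivative_const)
      then show ?thesis
        using slice[of "\<lambda>s. (r, s, t)" "(0, 1, 0)" \<theta> UNIV] rt by (simp add: image_subset_iff)
    qed
    show "((\<lambda>s. f r \<theta> s) has_real_derivative F (r, \<theta>, t) (0, 0, 1)) (at t within {0..<T})"
    proof -
      have "((\<lambda>s. (r, \<theta>, s)) has_derivative (\<lambda>h. (0, 0, h))) (at t within {0..<T})"
        by (intro has_derivative_Pair has_derivative_ident has_derivative_const)
      then show ?thesis
        using slice[of "\<lambda>s. (r, \<theta>, s)" "(0, 0, 1)" t "{0..<T}"] rt by (simp add: image_subset_iff)
    qed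
  qed
  then show ?thesis using that by blast
qed

text \<open>\<open>d_r\<close> is a two-sided derivative and would see values outside the annulus at
  a boundary circle, hence the open interval for \<open>r\<close>.\<close>

lemma has_partials_eq:
  assumes "has_partials r0 r1 T f fr f\<theta> ft" "r \<in> {r0<..<r1}" "t \<in> {0..<T}"
  shows "d_r f r \<theta> t = fr r \<theta> t" "d_theta f r \<theta> t = f\<theta> r \<theta> t" "d_t f r \<theta> t = ft r \<theta> t"
proof -
  have r: "r \<in> {r0..r1}" using assms(2) by auto
  note D = has_partials_D[OF assms(1) r assms(3), of \<theta>]
  have "((\<lambda>s. f s \<theta> t) has_real_derivative fr r \<theta> t) (at r)"
    using D(1) assms(2) by (simp add: at_within_Icc_at)
  then show "d_r f r \<theta> t = fr r \<theta> t"
    unfolding d_r_def by (rule DERIV_imp_deriv)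
  show "d_theta f r \<theta> t = f\<theta> r \<theta> t"
    unfolding d_theta_def using D(2) by (rule DERIV_imp_deriv)
  show "d_t f r \<theta> t = ft r \<theta> t"
    unfolding d_t_def using D(3) assms(3) by (rule time_deriv_eq)
qed

text \<open>The equations and the initial condition are given in the open annulus only;
  continuity extends them to the boundary circles.\<close>

lemma eq_on_closed_annulus:
  fixes g :: "real \<times> real \<times> real \<Rightarrow> real"
  assumes "r0 < r1" "continuous_on ({r0..r1} \<times> UNIV \<times> {0..<T}) g"
    and eq: "\<And>r \<theta>. r \<in> {r0<..<r1} \<Longrightarrow> g (r, \<theta>, t) = 0"
    and "r \<in> {r0..r1}" "t \<in> {0..<T}"
  shows "g (r, \<theta>, t) = 0"
proof -
  have "continuous_on {r0..r1} (\<lambda>s. g (s, \<theta>, t))"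
    by (rule continuous_on_compose2[OF assms(2)]) (use assms(5) in \<open>auto intro!: continuous_intros\<close>)
  then show ?thesis
    using continuous_constant_on_closure[of "{r0<..<r1}" "\<lambda>s. g (s, \<theta>, t)" 0 r] assms by simp
qed

text \<open>In the open annulus the density is positive, so \<open>\<rho> powr (3 - 2)\<close> is
  simply \<rho>. The left-hand sides then become polynomials in the partial derivatives and
  \<open>inverse r\<close>; these are continuous up to the boundary circles, and so the equations
  persist there.\<close>

lemma euler_solution_3_closed:
  assumes sol: "euler_solution 3 r0 r1 T ur0 ut0 \<rho>0 u v \<rho>" and "0 < r0" "r0 < r1"
    and u: "has_partials r0 r1 T u ur u\<theta> ut" and v: "has_partials r0 r1 T v vr v\<theta> vt"
    and \<rho>: "has_partials r0 r1 T \<rho> \<rho>r \<rho>\<theta> \<rho>t"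
    and r: "r \<in> {r0..r1}" and t: "t \<in> {0..<T}"
  shows "ut r \<theta> t + u r \<theta> t * ur r \<theta> t + inverse r * v r \<theta> t * u\<theta> r \<theta> t
      - inverse r * (v r \<theta> t)\<^sup>2 + \<rho> r \<theta> t * \<rho>r r \<theta> t = 0"
    and "vt r \<theta> t + u r \<theta> t * vr r \<theta> t + inverse r * v r \<theta> t * v\<theta> r \<theta> t
      + inverse r * u r \<theta> t * v r \<theta> t + inverse r * \<rho> r \<theta> t * \<rho>\<theta> r \<theta> t = 0"
    and "\<rho>t r \<theta> t + u r \<theta> t * \<rho>r r \<theta> t + inverse r * v r \<theta> t * \<rho>\<theta> r \<theta> t
      + \<rho> r \<theta> t * (inverse r * u r \<theta> t + ur r \<theta> t + inverse r * v\<theta> r \<theta> t) = 0"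
proof -
  have eqs: "\<rho> r \<theta> t > 0" "euler_equations_at 3 u v \<rho> r \<theta> t"
    if "r \<in> {r0<..<r1}" for r \<theta>
    using sol t that unfolding euler_solution_def by blast+
  note cont = has_partials_continuous[OF u, of u] has_partials_continuous[OF u, of ur]
    has_partials_continuous[OF u, of u\<theta>] has_partials_continuous[OF u, of ut]
    has_partials_continuous[OF v, of v] has_partials_continuous[OF v, of vr]
    has_partials_continuous[OF v, of v\<theta>] has_partials_continuous[OF v, of vt]
    has_partials_continuous[OF \<rho>, of \<rho>] has_partials_continuous[OF \<rho>, of \<rho>r]
    has_partials_continuous[OF \<rho>, of \<rho>\<theta>] has_partials_continuous[OF \<rho>, of \<rho>t]
  have inv: "continuous_on ({r0..r1} \<times> UNIV \<times> {0..<T}) (\<lambda>x::real \<times> real \<times> real. inverse (fst x))"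
    using \<open>0 < r0\<close> by (intro continuous_intros) auto
  note eqs' = conjunct1[OF eqs(2)[unfolded euler_equations_at_def material_deriv_def]]
    conjunct1[OF conjunct2[OF eqs(2)[unfolded euler_equations_at_def material_deriv_def]]]
    conjunct2[OF conjunct2[OF eqs(2)[unfolded euler_equations_at_def material_deriv_def]]]
  note eq = has_partials_eq[OF u _ t] has_partials_eq[OF v _ t] has_partials_eq[OF \<rho> _ t]
  let ?g = "\<lambda>(g :: field) x. g (fst x) (fst (snd x)) (snd (snd x))"
  have "(\<lambda>x. ?g ut x + ?g u x * ?g ur x + inverse (fst x) * ?g v x * ?g u\<theta> x
      - inverse (fst x) * (?g v x)\<^sup>2 + ?g \<rho> x * ?g \<rho>r x) (r, \<theta>, t) = 0"
  proof (rule eq_on_closed_annulus[OF \<open>r0 < r1\<close> _ _ r t], goal_cases)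
    case 1
    show ?case by (intro continuous_intros cont inv) auto
  next
    case (2 s \<phi>)
    then show ?case using eqs(1)[OF 2, of \<phi>] eqs'(1)[OF 2, of \<phi>] by (simp add: eq divide_inverse)
  qed
  then show "ut r \<theta> t + u r \<theta> t * ur r \<theta> t + inverse r * v r \<theta> t * u\<theta> r \<theta> t
      - inverse r * (v r \<theta> t)\<^sup>2 + \<rho> r \<theta> t * \<rho>r r \<theta> t = 0" by simp
  have "(\<lambda>x. ?g vt x + ?g u x * ?g vr x + inverse (fst x) * ?g v x * ?g v\<theta> x
      + inverse (fst x) * ?g u x * ?g v x + inverse (fst x) * ?g \<rho> x * ?g \<rho>\<theta> x) (r, \<theta>, t) = 0"
  proof (rule eq_on_closed_annulus[OF \<open>r0 < r1\<close> _ _ r t], goal_cases)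
    case 1
    show ?case by (intro continuous_intros cont inv) auto
  next
    case (2 s \<phi>)
    then show ?case using eqs(1)[OF 2, of \<phi>] eqs'(2)[OF 2, of \<phi>] by (simp add: eq divide_inverse)
  qed
  then show "vt r \<theta> t + u r \<theta> t * vr r \<theta> t + inverse r * v r \<theta> t * v\<theta> r \<theta> t
      + inverse r * u r \<theta> t * v r \<theta> t + inverse r * \<rho> r \<theta> t * \<rho>\<theta> r \<theta> t = 0" by simp
  have "(\<lambda>x. ?g \<rho>t x + ?g u x * ?g \<rho>r x + inverse (fst x) * ?g v x * ?g \<rho>\<theta> x
      + ?g \<rho> x * (inverse (fst x) * ?g u x + ?g ur x + inverse (fst x) * ?g v\<theta> x)) (r, \<theta>, t) = 0"
  proof (rule eq_on_closed_annulus[OF \<open>r0 < r1\<close> _ _ r t], goal_cases)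
    case 1
    show ?case by (intro continuous_intros cont inv) auto
  next
    case (2 s \<phi>)
    then show ?case using eqs(1)[OF 2, of \<phi>] eqs'(3)[OF 2, of \<phi>] by (simp add: eq divide_inverse)
  qed
  then show "\<rho>t r \<theta> t + u r \<theta> t * \<rho>r r \<theta> t + inverse r * v r \<theta> t * \<rho>\<theta> r \<theta> t
      + \<rho> r \<theta> t * (inverse r * u r \<theta> t + ur r \<theta> t + inverse r * v\<theta> r \<theta> t) = 0" by simp
qed

section \<open>Uniqueness for the Euler system\<close>

text \<open>For \<open>\<gamma> = 3\<close> the system is symmetric hyperbolic in \<open>(u, v, \<rho>)\<close>, so that the quadratic energy
  of the difference of two solutions obeys a balance law with flux \<open>P\<close>, \<open>Q\<close> whose source is
  again quadratic. Here \<open>i\<close> stands for \<open>1 / r\<close>.\<close>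

lemma euler_3_energy_balance:
  fixes i :: real
  assumes 1: "ut + u * ur + i * v * u\<theta> - i * v\<^sup>2 + \<rho> * \<rho>r = 0"
      "vt + u * vr + i * v * v\<theta> + i * u * v + i * \<rho> * \<rho>\<theta> = 0"
      "\<rho>t + u * \<rho>r + i * v * \<rho>\<theta> + \<rho> * (i * u + ur + i * v\<theta>) = 0"
    and 2: "Ut + U * Ur + i * V * U\<theta> - i * V\<^sup>2 + R * Rr = 0"
      "Vt + U * Vr + i * V * V\<theta> + i * U * V + i * R * R\<theta> = 0"
      "Rt + U * Rr + i * V * R\<theta> + R * (i * U + Ur + i * V\<theta>) = 0"
    and [simp]: "a = U - u" "b = V - v" "c = R - \<rho>"
  shows "2 * (a * (Ut - ut) + b * (Vt - vt) + c * (Rt - \<rho>t))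
    + (Ur * (a\<^sup>2 + b\<^sup>2 + c\<^sup>2) + U * (2 * (a * (Ur - ur) + b * (Vr - vr) + c * (Rr - \<rho>r)))
       + 2 * (Rr * a * c + R * (Ur - ur) * c + R * a * (Rr - \<rho>r)))
    + i * (V\<theta> * (a\<^sup>2 + b\<^sup>2 + c\<^sup>2) + V * (2 * (a * (U\<theta> - u\<theta>) + b * (V\<theta> - v\<theta>) + c * (R\<theta> - \<rho>\<theta>)))
       + 2 * (R\<theta> * b * c + R * (V\<theta> - v\<theta>) * c + R * b * (R\<theta> - \<rho>\<theta>)))
    = (Ur + i * V\<theta> - 2 * ur) * a\<^sup>2 + (Ur + i * V\<theta> - 2 * i * v\<theta> - 2 * i * u) * b\<^sup>2
      + (Ur + i * V\<theta> - 2 * i * U - 2 * ur - 2 * i * v\<theta>) * c\<^sup>2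
      + (2 * i * (V + v) - 2 * i * u\<theta> - 2 * vr - 2 * i * V) * (a * b)
      + (2 * Rr - 4 * \<rho>r - 2 * i * \<rho>) * (a * c)
      + (2 * i * R\<theta> - 4 * i * \<rho>\<theta>) * (b * c)"
proof -
  \<comment> \<open>The equations serve to eliminate the six time derivatives; what remains is a
    polynomial identity.\<close>
  have eqs: "ut = - (u * ur + i * v * u\<theta> - i * v\<^sup>2 + \<rho> * \<rho>r)"
    "vt = - (u * vr + i * v * v\<theta> + i * u * v + i * \<rho> * \<rho>\<theta>)"
    "\<rho>t = - (u * \<rho>r + i * v * \<rho>\<theta> + \<rho> * (i * u + ur + i * v\<theta>))"
    "Ut = - (U * Ur + i * V * U\<theta> - i * V\<^sup>2 + R * Rr)"
    "Vt = - (U * Vr + i * V * V\<theta> + i * U * V + i * R * R\<theta>)"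
    "Rt = - (U * Rr + i * V * R\<theta> + R * (i * U + Ur + i * V\<theta>))"
    using 1 2 by linarith+
  show ?thesis
    unfolding eqs by (simp add: power2_eq_square algebra_simps)
qed

text \<open>Each of the six monomials is at most \<open>a\<^sup>2 + b\<^sup>2 + c\<^sup>2\<close> in
  absolute value. No sharp constant is sought, since the result only feeds Gronwall's
  inequality.\<close>

lemma quadratic_form_le:
  fixes a b c :: real
  shows "k1 * a\<^sup>2 + k2 * b\<^sup>2 + k3 * c\<^sup>2 + k4 * (a * b) + k5 * (a * c) + k6 * (b * c)
    \<le> (\<bar>k1\<bar> + \<bar>k2\<bar> + \<bar>k3\<bar> + \<bar>k4\<bar> + \<bar>k5\<bar> + \<bar>k6\<bar>) * (a\<^sup>2 + b\<^sup>2 + c\<^sup>2)"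
proof -
  let ?e = "a\<^sup>2 + b\<^sup>2 + c\<^sup>2"
  have *: "k * x \<le> \<bar>k\<bar> * ?e" if "\<bar>x\<bar> \<le> ?e" for k x :: real
    using mult_mono[OF order_refl that, of "\<bar>k\<bar>"] abs_le_D1[of "k * x" "\<bar>k\<bar> * \<bar>x\<bar>"]
    by (simp add: abs_mult)
  have xy: "\<bar>x * y\<bar> \<le> x\<^sup>2 + y\<^sup>2" for x y :: real
    using sum_squares_bound[of "\<bar>x\<bar>" "\<bar>y\<bar>"] zero_le_mult_iff[of "\<bar>x\<bar>" "\<bar>y\<bar>"]
    unfolding abs_mult power2_abs by linarith
  have "k1 * a\<^sup>2 \<le> \<bar>k1\<bar> * ?e" "k2 * b\<^sup>2 \<le> \<bar>k2\<bar> * ?e" "k3 * c\<^sup>2 \<le> \<bar>k3\<bar> * ?e"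
    by (rule *; simp)+
  moreover have "k4 * (a * b) \<le> \<bar>k4\<bar> * ?e" "k5 * (a * c) \<le> \<bar>k5\<bar> * ?e" "k6 * (b * c) \<le> \<bar>k6\<bar> * ?e"
    using xy[of a b] xy[of a c] xy[of b c] zero_le_power2[of a] zero_le_power2[of b]
      zero_le_power2[of c] by (intro *; linarith)+
  ultimately show ?thesis
    by (simp only: distrib_right)
qed

lemma euler_solution_3_unique:
  assumes sol: "euler_solution 3 r0 r1 T ur0 ut0 \<rho>0 u v \<rho>"
    and sol': "euler_solution 3 r0 r1 T ur0 ut0 \<rho>0 U V R"
    and "0 < r0" "r0 < r1" and r: "r \<in> {r0..r1}" and t: "t \<in> {0..<T}"
  shows "U r \<theta> t = u r \<theta> t \<and> V r \<theta> t = v r \<theta> t \<and> R r \<theta> t = \<rho> r \<theta> t"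
proof -
  have Ck: "Ck_on 1 (\<lambda>(r, \<theta>, t). f r \<theta> t) ({r0..r1} \<times> UNIV \<times> {0..<T})"
    if "smooth_field r0 r1 T f" for f
    using that unfolding smooth_field_def smooth_on_def by blast
  obtain ur u\<theta> ut where u: "has_partials r0 r1 T u ur u\<theta> ut"
    using sol unfolding euler_solution_def by (metis Ck Ck_on_has_partials)
  obtain vr v\<theta> vt where v: "has_partials r0 r1 T v vr v\<theta> vt"
    using sol unfolding euler_solution_def by (metis Ck Ck_on_has_partials)
  obtain \<rho>r \<rho>\<theta> \<rho>t where \<rho>: "has_partials r0 r1 T \<rho> \<rho>r \<rho>\<theta> \<rho>t"
    using sol unfolding euler_solution_def by (metis Ck Ck_on_has_partials)
  obtain Ur U\<theta> Ut where U: "has_partials r0 r1 T U Ur U\<theta> Ut"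
    using sol' unfolding euler_solution_def by (metis Ck Ck_on_has_partials)
  obtain Vr V\<theta> Vt where V: "has_partials r0 r1 T V Vr V\<theta> Vt"
    using sol' unfolding euler_solution_def by (metis Ck Ck_on_has_partials)
  obtain Rr R\<theta> Rt where R: "has_partials r0 r1 T R Rr R\<theta> Rt"
    using sol' unfolding euler_solution_def by (metis Ck Ck_on_has_partials)
  define a where "a r \<theta> t = U r \<theta> t - u r \<theta> t" for r \<theta> t
  define b where "b r \<theta> t = V r \<theta> t - v r \<theta> t" for r \<theta> t
  define c where "c r \<theta> t = R r \<theta> t - \<rho> r \<theta> t" for r \<theta> t
  define e where "e r \<theta> t = (a r \<theta> t)\<^sup>2 + (b r \<theta> t)\<^sup>2 + (c r \<theta> t)\<^sup>2" for r \<theta> t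
  define et where "et r \<theta> t = 2 * (a r \<theta> t * (Ut r \<theta> t - ut r \<theta> t) + b r \<theta> t * (Vt r \<theta> t - vt r \<theta> t)
    + c r \<theta> t * (Rt r \<theta> t - \<rho>t r \<theta> t))" for r \<theta> t
  \<comment> \<open>The first term is transport of energy by \<open>U\<close>, the second comes from
    the coupling of velocity and density. On the boundary circles \<open>U\<close> and
    \<open>a\<close> are zero by the no-flux condition, so both terms vanish there.\<close>
  define P where "P r \<theta> t = U r \<theta> t * e r \<theta> t + 2 * (R r \<theta> t * a r \<theta> t * c r \<theta> t)" for r \<theta> t
  define Q where "Q r \<theta> t = inverse r * (V r \<theta> t * e r \<theta> t + 2 * (R r \<theta> t * b r \<theta> t * c r \<theta> t))"
    for r \<theta> t
  define Pr where "Pr r \<theta> t = Ur r \<theta> t * ((a r \<theta> t)\<^sup>2 + (b r \<theta> t)\<^sup>2 + (c r \<theta> t)\<^sup>2)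
      + U r \<theta> t * (2 * (a r \<theta> t * (Ur r \<theta> t - ur r \<theta> t) + b r \<theta> t * (Vr r \<theta> t - vr r \<theta> t)
        + c r \<theta> t * (Rr r \<theta> t - \<rho>r r \<theta> t)))
      + 2 * (Rr r \<theta> t * a r \<theta> t * c r \<theta> t + R r \<theta> t * (Ur r \<theta> t - ur r \<theta> t) * c r \<theta> t
        + R r \<theta> t * a r \<theta> t * (Rr r \<theta> t - \<rho>r r \<theta> t))" for r \<theta> t
  define Q\<theta> where "Q\<theta> r \<theta> t = inverse r * (V\<theta> r \<theta> t * ((a r \<theta> t)\<^sup>2 + (b r \<theta> t)\<^sup>2 + (c r \<theta> t)\<^sup>2)
      + V r \<theta> t * (2 * (a r \<theta> t * (U\<theta> r \<theta> t - u\<theta> r \<theta> t) + b r \<theta> t * (V\<theta> r \<theta> t - v\<theta> r \<theta> t)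
        + c r \<theta> t * (R\<theta> r \<theta> t - \<rho>\<theta> r \<theta> t)))
      + 2 * (R\<theta> r \<theta> t * b r \<theta> t * c r \<theta> t + R r \<theta> t * (V\<theta> r \<theta> t - v\<theta> r \<theta> t) * c r \<theta> t
        + R r \<theta> t * b r \<theta> t * (R\<theta> r \<theta> t - \<rho>\<theta> r \<theta> t)))" for r \<theta> t
  \<comment> \<open>The absolute values of the six source coefficients in
    \<open>euler_3_energy_balance\<close>, summed as in \<open>quadratic_form_le\<close>.\<close>
  define k where "k r \<theta> t =
      \<bar>Ur r \<theta> t + inverse r * V\<theta> r \<theta> t - 2 * ur r \<theta> t\<bar>
      + \<bar>Ur r \<theta> t + inverse r * V\<theta> r \<theta> t - 2 * inverse r * v\<theta> r \<theta> t - 2 * inverse r * u r \<theta> t\<bar>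
      + \<bar>Ur r \<theta> t + inverse r * V\<theta> r \<theta> t - 2 * inverse r * U r \<theta> t - 2 * ur r \<theta> t
        - 2 * inverse r * v\<theta> r \<theta> t\<bar>
      + \<bar>2 * inverse r * (V r \<theta> t + v r \<theta> t) - 2 * inverse r * u\<theta> r \<theta> t - 2 * vr r \<theta> t
        - 2 * inverse r * V r \<theta> t\<bar>
      + \<bar>2 * Rr r \<theta> t - 4 * \<rho>r r \<theta> t - 2 * inverse r * \<rho> r \<theta> t\<bar>
      + \<bar>2 * inverse r * R\<theta> r \<theta> t - 4 * inverse r * \<rho>\<theta> r \<theta> t\<bar>" for r \<theta> t
  let ?S = "{r0..r1} \<times> (UNIV :: real set) \<times> {0..<T}"
  \<comment> \<open>The period begins at the angle in question, which therefore lies in the box.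
    Time ends at \<open>t < T\<close>, so the box is compact and \<open>k\<close> is bounded on it,
    even if derivatives blow up at \<open>T\<close>.\<close>
  let ?D = "{r0..r1} \<times> {\<theta>..\<theta> + 2 * pi} \<times> {0..t}"
  have DS: "?D \<subseteq> ?S" using t by auto
  have inv: "continuous_on ?S (\<lambda>x. inverse (fst x))"
    using \<open>0 < r0\<close> by (intro continuous_intros) auto
  note cont =
    has_partials_continuous[OF u, of u] has_partials_continuous[OF u, of ur]
    has_partials_continuous[OF u, of u\<theta>] has_partials_continuous[OF u, of ut]
    has_partials_continuous[OF v, of v] has_partials_continuous[OF v, of vr]
    has_partials_continuous[OF v, of v\<theta>] has_partials_continuous[OF v, of vt]
    has_partials_continuous[OF \<rho>, of \<rho>] has_partials_continuous[OF \<rho>, of \<rho>r]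
    has_partials_continuous[OF \<rho>, of \<rho>\<theta>] has_partials_continuous[OF \<rho>, of \<rho>t]
    has_partials_continuous[OF U, of U] has_partials_continuous[OF U, of Ur]
    has_partials_continuous[OF U, of U\<theta>] has_partials_continuous[OF U, of Ut]
    has_partials_continuous[OF V, of V] has_partials_continuous[OF V, of Vr]
    has_partials_continuous[OF V, of V\<theta>] has_partials_continuous[OF V, of Vt]
    has_partials_continuous[OF R, of R] has_partials_continuous[OF R, of Rr]
    has_partials_continuous[OF R, of R\<theta>] has_partials_continuous[OF R, of Rt]
  note cont_rules = continuous_on_add continuous_on_diff continuous_on_mult continuous_on_power
    continuous_on_rabs continuous_on_const inv cont[simplified insert_iff refl simp_thms, OF TrueI]
  have "continuous_on ?S (\<lambda>(r, \<theta>, t). e r \<theta> t)"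
    unfolding e_def a_def b_def c_def case_prod_unfold by (intro cont_rules)
  then have ce: "continuous_on ?D (\<lambda>(r, \<theta>, t). e r \<theta> t)"
    by (rule continuous_on_subset[OF _ DS])
  have "continuous_on ?S (\<lambda>(r, \<theta>, t). et r \<theta> t)"
    unfolding et_def a_def b_def c_def case_prod_unfold by (intro cont_rules)
  then have cet: "continuous_on ?D (\<lambda>(r, \<theta>, t). et r \<theta> t)"
    by (rule continuous_on_subset[OF _ DS])
  have "continuous_on ?S (\<lambda>(r, \<theta>, t). Pr r \<theta> t)"
    unfolding Pr_def a_def b_def c_def case_prod_unfold by (intro cont_rules)
  then have cP: "continuous_on ?D (\<lambda>(r, \<theta>, t). Pr r \<theta> t)"
    by (rule continuous_on_subset[OF _ DS])
  have "continuous_on ?S (\<lambda>(r, \<theta>, t). Q\<theta> r \<theta> t)"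
    unfolding Q\<theta>_def a_def b_def c_def case_prod_unfold by (intro cont_rules)
  then have cQ: "continuous_on ?D (\<lambda>(r, \<theta>, t). Q\<theta> r \<theta> t)"
    by (rule continuous_on_subset[OF _ DS])
  have "continuous_on ?S (\<lambda>(r, \<theta>, t). k r \<theta> t)"
    unfolding k_def case_prod_unfold by (intro cont_rules)
  then have "continuous_on ?D (\<lambda>(r, \<theta>, t). k r \<theta> t)"
    by (rule continuous_on_subset[OF _ DS])
  moreover have "compact ?D" by (intro compact_Times) auto
  ultimately have "bdd_above ((\<lambda>(r, \<theta>, t). k r \<theta> t) ` ?D)"
    by (intro bounded_imp_bdd_above compact_imp_bounded compact_continuous_image)
  then obtain K where K: "\<And>x. x \<in> ?D \<Longrightarrow> (\<lambda>(r, \<theta>, t). k r \<theta> t) x \<le> K"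
    unfolding bdd_above_def by blast
  have D: "r \<in> {r0..r1}" "s \<in> {0..<T}" if "(r, \<phi>, s) \<in> ?D" for r \<phi> s
    using that t by auto
  have "e r \<theta> t = 0"
  proof (rule energy_zero[where \<alpha> = \<theta> and \<beta> = "\<theta> + 2 * pi" and P = P and Q = Q and C = K,
        OF \<open>r0 < r1\<close> _ _ ce cet cP cQ])
    fix r \<phi> s assume *: "(r, \<phi>, s) \<in> ?D"
    note D = D[OF *]
    show "((\<lambda>s. e r \<phi> s) has_real_derivative et r \<phi> s) (at s within {0..t})"
    proof (rule DERIV_subset)
      show "((\<lambda>s. e r \<phi> s) has_real_derivative et r \<phi> s) (at s within {0..<T})"
        unfolding e_def et_def a_def b_def c_def
        by (rule derivative_eq_intros has_partials_D(3)[OF u D] has_partials_D(3)[OF v D]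
            has_partials_D(3)[OF \<rho> D] has_partials_D(3)[OF U D] has_partials_D(3)[OF V D]
            has_partials_D(3)[OF R D] refl)+ (simp add: algebra_simps)
    qed (use t in auto)
    show "((\<lambda>x. P x \<phi> s) has_real_derivative Pr r \<phi> s) (at r within {r0..r1})"
      unfolding P_def Pr_def e_def a_def b_def c_def
      by (rule derivative_eq_intros has_partials_D(1)[OF u D] has_partials_D(1)[OF v D]
          has_partials_D(1)[OF \<rho> D] has_partials_D(1)[OF U D] has_partials_D(1)[OF V D]
          has_partials_D(1)[OF R D] refl)+ (simp add: algebra_simps power2_eq_square)
    have "((\<lambda>\<theta>. Q r \<theta> s) has_real_derivative Q\<theta> r \<phi> s) (at \<phi>)"
      unfolding Q_def Q\<theta>_def e_def a_def b_def c_def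
      by (rule derivative_eq_intros has_partials_D(2)[OF u D] has_partials_D(2)[OF v D]
          has_partials_D(2)[OF \<rho> D] has_partials_D(2)[OF U D] has_partials_D(2)[OF V D]
          has_partials_D(2)[OF R D] refl)+ (simp add: algebra_simps power2_eq_square)
    then show "((\<lambda>\<theta>. Q r \<theta> s) has_real_derivative Q\<theta> r \<phi> s) (at \<phi> within {\<theta>..\<theta> + 2 * pi})"
      by (rule has_field_derivative_at_within)
    show "0 \<le> e r \<phi> s" by (simp add: e_def)
    have "et r \<phi> s + Pr r \<phi> s + Q\<theta> r \<phi> s \<le> k r \<phi> s * e r \<phi> s"
      unfolding et_def Pr_def Q\<theta>_def k_def e_def
      by (subst euler_3_energy_balance[OF
            euler_solution_3_closed[OF sol \<open>0 < r0\<close> \<open>r0 < r1\<close> u v \<rho> D, of \<phi>]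
            euler_solution_3_closed[OF sol' \<open>0 < r0\<close> \<open>r0 < r1\<close> U V R D, of \<phi>]
            a_def b_def c_def])
        (rule quadratic_form_le)
    also have "\<dots> \<le> K * e r \<phi> s"
      using K[OF *] by (intro mult_right_mono) (simp_all add: e_def)
    finally show "et r \<phi> s + Pr r \<phi> s + Q\<theta> r \<phi> s \<le> K * e r \<phi> s" .
  next
    fix \<phi> s assume "s \<in> {0..t}"
    then have "s \<in> {0..<T}" using t by auto
    then show "P r0 \<phi> s = P r1 \<phi> s"
      using sol sol' unfolding euler_solution_def P_def a_def by simp
  next
    fix r s assume "r \<in> {r0..r1}" "s \<in> {0..t}"
    moreover from this have "s \<in> {0..<T}" using t by auto
    moreover have "smooth_field r0 r1 T f" if "f \<in> {u, v, \<rho>, U, V, R}" for f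
      using that sol sol' unfolding euler_solution_def by auto
    ultimately have per: "f r (\<theta> + 2 * pi) s = f r \<theta> s" if "f \<in> {u, v, \<rho>, U, V, R}" for f
      using that unfolding smooth_field_def periodic_def by blast
    show "Q r \<theta> s = Q r (\<theta> + 2 * pi) s"
      unfolding Q_def e_def a_def b_def c_def
      by (simp add: per[of u] per[of v] per[of \<rho>] per[of U] per[of V] per[of R])
  next
    fix r \<phi> assume r: "r \<in> {r0..r1}"
    have 0: "0 \<in> {0..<T}" using t by auto
    have init: "f r \<phi> 0 - g r \<phi> 0 = 0"
      if "continuous_on ?S (\<lambda>x. f (fst x) (fst (snd x)) (snd (snd x)))"
        "continuous_on ?S (\<lambda>x. g (fst x) (fst (snd x)) (snd (snd x)))"
        "\<And>r \<theta>. r \<in> {r0<..<r1} \<Longrightarrow> f r \<theta> 0 = g r \<theta> 0" for f g :: field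
      using eq_on_closed_annulus[OF \<open>r0 < r1\<close> continuous_on_diff[OF that(1,2)] _ r 0] that(3)
      by simp
    have eqs: "U r \<theta> 0 = u r \<theta> 0" "V r \<theta> 0 = v r \<theta> 0" "R r \<theta> 0 = \<rho> r \<theta> 0"
      if "r \<in> {r0<..<r1}" for r \<theta>
      using that sol sol' unfolding euler_solution_def by auto
    have "a r \<phi> 0 = 0" "b r \<phi> 0 = 0" "c r \<phi> 0 = 0"
      unfolding a_def b_def c_def
      by (rule init, rule cont_rules, rule cont_rules, erule eqs)+
    then show "e r \<phi> 0 = 0" by (simp add: e_def)
  qed (use r t in auto)
  then have "a r \<theta> t = 0" "b r \<theta> t = 0" "c r \<theta> t = 0"
    unfolding e_def by (simp_all add: add_nonneg_eq_0_iff)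
  then show ?thesis by (simp add: a_def b_def c_def)
qed

section \<open>Burgers' equation\<close>

text \<open>The slope bound is what keeps characteristics apart before time \<epsilon>. That it is
  attained is assumed separately where blow-up is proved.\<close>

locale burgers_data =
  fixes w0 :: "real \<Rightarrow> real" and \<epsilon> :: real
  assumes periodic: "periodic w0" and smooth: "smooth_on w0 UNIV" and \<epsilon>: "0 < \<epsilon>"
    and deriv_ge: "\<And>\<theta>. - (1 / \<epsilon>) \<le> deriv w0 \<theta>"
begin

section \<open>The flow map before the critical time\<close>

lemmas DERIV_w0 = smooth_on_deriv(1)[OF smooth]

lemma jacobian_pos:
  assumes "t \<in> {0..<\<epsilon>}"
  shows "0 < 1 + t * deriv w0 y"
proof -
  have "- (t / \<epsilon>) \<le> t * deriv w0 y"
    using mult_left_mono[OF deriv_ge, of t y] assms by simp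
  moreover have "t / \<epsilon> < 1" using assms by simp
  ultimately show ?thesis by linarith
qed

text \<open>By the slope bound \<open>y / \<epsilon> + w0 y\<close> is nondecreasing, and
  \<open>t\<close> times it is the flow map minus \<open>(1 - t / \<epsilon>) * y\<close>. The
  explicit rate yields injectivity, the bracket for surjectivity and the continuity of the
  foot.\<close>

lemma flow_expand:
  assumes "t \<in> {0..<\<epsilon>}"
  shows "(1 - t / \<epsilon>) * \<bar>y - z\<bar> \<le> \<bar>(y + t * w0 y) - (z + t * w0 z)\<bar>"
proof -
  have *: "(1 - t / \<epsilon>) * (y - z) \<le> (y + t * w0 y) - (z + t * w0 z)" if "z \<le> y" for y z
  proof -
    have "z / \<epsilon> + w0 z \<le> y / \<epsilon> + w0 y"
    proof (rule DERIV_nonneg_imp_nondecreasing[OF that])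
      fix x
      have "((\<lambda>y. y / \<epsilon> + w0 y) has_real_derivative 1 / \<epsilon> + deriv w0 x) (at x)"
        using \<epsilon> by (auto intro!: derivative_eq_intros DERIV_w0)
      then show "\<exists>D. ((\<lambda>y. y / \<epsilon> + w0 y) has_real_derivative D) (at x) \<and> 0 \<le> D"
        using deriv_ge[of x] by (intro exI conjI) auto
    qed
    then have "t * (z / \<epsilon> + w0 z) \<le> t * (y / \<epsilon> + w0 y)"
      using assms by (intro mult_left_mono) auto
    then show ?thesis by (simp add: algebra_simps diff_divide_distrib)
  qed
  have "0 \<le> 1 - t / \<epsilon>" using assms by simp
  show ?thesis
  proof (cases "z \<le> y")
    case True
    then show ?thesis using *[OF True] by simp
  next
    case False
    then show ?thesis using *[of y z] by (simp add: abs_if)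
  qed
qed

lemma flow_inj:
  assumes "t \<in> {0..<\<epsilon>}" "y + t * w0 y = z + t * w0 z"
  shows "y = z"
proof -
  have "0 < 1 - t / \<epsilon>" using assms(1) by simp
  moreover have "(1 - t / \<epsilon>) * \<bar>y - z\<bar> \<le> 0"
    using flow_expand[OF assms(1), of y z] assms(2) by simp
  ultimately show ?thesis by (simp add: mult_le_0_iff)
qed

lemma flow_strict_mono:
  assumes t: "t \<in> {0..<\<epsilon>}" and "z < y"
  shows "z + t * w0 z < y + t * w0 y"
proof (rule DERIV_pos_imp_increasing[OF \<open>z < y\<close>])
  fix x
  have "((\<lambda>y. y + t * w0 y) has_real_derivative 1 + t * deriv w0 x) (at x)"
    by (auto intro!: derivative_eq_intros DERIV_w0)
  then show "\<exists>D. ((\<lambda>y. y + t * w0 y) has_real_derivative D) (at x) \<and> 0 < D"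
    using jacobian_pos[OF t] by blast
qed

lemma continuous_w0: "continuous_on A w0"
  using DERIV_w0 DERIV_continuous_on has_field_derivative_at_within by blast

lemma flow_surj:
  assumes t: "t \<in> {0..<\<epsilon>}"
  shows "\<exists>y. y + t * w0 y = \<theta>"
proof -
  let ?F = "\<lambda>y. y + t * w0 y" and ?m = "1 - t / \<epsilon>"
  \<comment> \<open>By \<open>flow_expand\<close>, the values of the flow map at \<open>N\<close>
    and \<open>- N\<close> are at distance at least \<open>?m * N\<close> from \<open>?F 0\<close>.
    This \<open>N\<close> makes that bound equal to the distance from \<open>?F 0\<close> to
    \<theta>, so \<theta> is bracketed and the intermediate value theorem applies.\<close>
  define N where "N = \<bar>\<theta> - ?F 0\<bar> / ?m"
  have m: "0 < ?m" using t by simp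
  have "0 \<le> N" unfolding N_def using m by (intro divide_nonneg_pos) auto
  moreover have "?m * N = \<bar>\<theta> - ?F 0\<bar>"
    using nonzero_mult_div_cancel_left[of ?m "\<bar>\<theta> - ?F 0\<bar>"] less_imp_neq[OF m]
    unfolding N_def times_divide_eq_right by auto
  ultimately have N: "0 \<le> N" "?m * N = \<bar>\<theta> - ?F 0\<bar>" by auto
  have mono: "?F x \<le> ?F y" if "x \<le> y" for x y
    using flow_strict_mono[OF t, of x y] that by (cases "x = y") auto
  have "?F (- N) \<le> \<theta>"
    using flow_expand[OF t, of "- N" 0] mono[of "- N" 0] N by simp
  moreover have "\<theta> \<le> ?F N"
    using flow_expand[OF t, of N 0] mono[of 0 N] N by simp
  moreover have "continuous_on {- N..N} ?F"
    by (intro continuous_intros continuous_w0)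
  ultimately show ?thesis
    using IVT'[of ?F "- N" \<theta> N] N(1) by auto
qed

text \<open>The foot at time \<open>0\<close> of the characteristic through \<open>(\<theta>, t)\<close>.\<close>

definition foot :: "real \<Rightarrow> real \<Rightarrow> real" where
  "foot \<theta> t = (THE y. y + t * w0 y = \<theta>)"

definition sol :: "real \<Rightarrow> real \<Rightarrow> real" where
  "sol \<theta> t = w0 (foot \<theta> t)"

lemma foot_unique: "t \<in> {0..<\<epsilon>} \<Longrightarrow> y + t * w0 y = \<theta> \<Longrightarrow> foot \<theta> t = y"
  unfolding foot_def using flow_inj by blast

lemma foot: "t \<in> {0..<\<epsilon>} \<Longrightarrow> foot \<theta> t + t * w0 (foot \<theta> t) = \<theta>"
  using flow_surj foot_unique by blast

section \<open>Regularity of the foot\<close>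

lemma continuous_on_foot: "continuous_on (UNIV \<times> {0..<\<epsilon>}) (\<lambda>x. foot (fst x) (snd x))"
proof (unfold continuous_on_def, intro ballI)
  fix p :: "real \<times> real"
  assume p: "p \<in> UNIV \<times> {0..<\<epsilon>}"
  let ?Y = "foot (fst p) (snd p)"
  let ?F = "at p within UNIV \<times> {0..<\<epsilon>}"
  \<comment> \<open>Both feet are carried forward to the same time \<open>snd x\<close>, where
    \<open>flow_expand\<close> compares them. The foot of \<open>p\<close> arrives at
    \<open>fst p + (snd x - snd p) * w0 ?Y\<close>, that of \<open>x\<close> at
    \<open>fst x\<close>; dividing by the expansion rate gives \<open>?g\<close>.\<close>
  let ?g = "\<lambda>x. \<bar>(fst x - fst p) - (snd x - snd p) * w0 ?Y\<bar> / (1 - snd x / \<epsilon>)"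
  have "\<forall>\<^sub>F x in ?F. norm (foot (fst x) (snd x) - ?Y) \<le> ?g x"
    unfolding eventually_at_filter
  proof (intro always_eventually allI impI)
    fix x :: "real \<times> real" assume x: "x \<in> UNIV \<times> {0..<\<epsilon>}"
    then have "snd x \<in> {0..<\<epsilon>}" "snd p \<in> {0..<\<epsilon>}" "0 < 1 - snd x / \<epsilon>"
      using p by auto
    moreover have "?Y + snd x * w0 ?Y = fst p + (snd x - snd p) * w0 ?Y"
      using foot[of "snd p" "fst p"] \<open>snd p \<in> _\<close> by (simp add: algebra_simps)
    ultimately show "norm (foot (fst x) (snd x) - ?Y) \<le> ?g x"
      using flow_expand[of "snd x" "foot (fst x) (snd x)" ?Y] foot[of "snd x" "fst x"]
      by (simp add: pos_le_divide_eq mult.commute diff_diff_add)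
  qed
  moreover have "(?g \<longlongrightarrow> 0) ?F"
  proof -
    have "1 - snd p / \<epsilon> \<noteq> 0" using p \<epsilon> by auto
    then show ?thesis using \<epsilon> by (auto intro!: tendsto_eq_intros)
  qed
  ultimately have "((\<lambda>x. foot (fst x) (snd x) - ?Y) \<longlongrightarrow> 0) ?F"
    by (rule Lim_null_comparison)
  then show "((\<lambda>x. foot (fst x) (snd x)) \<longlongrightarrow> ?Y) ?F"
    by (simp add: Lim_null[symmetric])
qed

text \<open>With time carried along as a second component, the flow is a bijection \<open>?f\<close>
  of the strip onto itself and \<open>?g\<close> is its inverse. Continuity of the inverse is
  already known, so inverting the triangular derivative of \<open>?f\<close> suffices, and this
  works within the strip, time \<open>0\<close> included.\<close>

lemma foot_has_derivative:
  assumes t: "t \<in> {0..<\<epsilon>}"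
  shows "((\<lambda>x. foot (fst x) (snd x)) has_derivative
      (\<lambda>v. (fst v - snd v * w0 (foot \<theta> t)) * inverse (1 + t * deriv w0 (foot \<theta> t))))
    (at (\<theta>, t) within UNIV \<times> {0..<\<epsilon>})"
proof -
  let ?S = "UNIV \<times> {0..<\<epsilon>}"
  let ?f = "\<lambda>x. (fst x + snd x * w0 (fst x), snd x)"
  let ?g = "\<lambda>x. (foot (fst x) (snd x), snd x)"
  let ?y = "foot \<theta> t"
  let ?J = "1 + t * deriv w0 ?y"
  let ?g' = "\<lambda>v. ((fst v - snd v * w0 ?y) * inverse ?J, snd v)"
  let ?f' = "\<lambda>v. (fst v + (t * (fst v * deriv w0 ?y) + snd v * w0 ?y), snd v)"
  have J: "?J \<noteq> 0" using jacobian_pos[OF t, of ?y] by simp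
  have fa: "?f (?y, t) = (\<theta>, t)" using foot[OF t] by simp
  have img: "?f ` ?S = ?S"
  proof (intro equalityI subsetI)
    fix x :: "real \<times> real" assume x: "x \<in> ?S"
    then have "x = ?f (?g x)" "?g x \<in> ?S" using foot[of "snd x" "fst x"] by auto
    then show "x \<in> ?f ` ?S" by blast
  qed auto
  have w0': "(w0 has_derivative (\<lambda>h. h * deriv w0 ?y)) (at (fst (?y, t)))"
    using DERIV_w0[of ?y] by (simp add: has_field_derivative_def mult_commute_abs)
  have "(?f has_derivative ?f') (at (?y, t) within ?S)"
    by (auto intro!: derivative_eq_intros has_derivative_compose[where f = fst and g = w0, OF _ w0'])
  moreover have "continuous (at (?f (?y, t)) within ?f ` ?S) ?g"
    unfolding fa img using continuous_on_foot t
    by (intro continuous_intros) (auto simp: continuous_on_eq_continuous_within)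
  moreover have "linear ?g'"
    by (intro linearI) (auto simp: algebra_simps)
  moreover have "?g' \<circ> ?f' = id"
    using J by (auto simp: fun_eq_iff field_simps)
  moreover have "?g (?f x) = x" if "x \<in> ?S" for x
    using that foot_unique[of "snd x" "fst x"] by (cases x) auto
  ultimately have "(?g has_derivative ?g') (at (?f (?y, t)) within ?f ` ?S)"
    using t by (intro has_derivative_inverse_within[where f' = ?f']) auto
  then have "(?g has_derivative ?g') (at (\<theta>, t) within ?S)"
    unfolding fa img .
  from has_derivative_fst[OF this] show ?thesis by simp
qed

text \<open>A bootstrap: the derivative of the foot involves the foot only through \<open>w0\<close>
  and \<open>deriv w0\<close>, so each order of regularity of the foot gives the same order for its
  derivative. \<open>jacobian_pos\<close> keeps the denominator away from zero.\<close>

lemma Ck_on_foot: "Ck_on k (\<lambda>x. foot (fst x) (snd x)) (UNIV \<times> {0..<\<epsilon>})"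
proof (induction k)
  case 0
  then show ?case using continuous_on_foot by simp
next
  case (Suc k)
  have w0: "Ck_on k w0 UNIV" using smooth unfolding smooth_on_def by blast
  show ?case
  proof (rule Ck_on_SucI)
    fix x :: "real \<times> real" assume "x \<in> UNIV \<times> {0..<\<epsilon>}"
    then show "((\<lambda>x. foot (fst x) (snd x)) has_derivative
      (\<lambda>v. (fst v + - snd v * w0 (foot (fst x) (snd x)))
        * inverse (1 + snd x * deriv w0 (foot (fst x) (snd x))))) (at x within UNIV \<times> {0..<\<epsilon>})"
      using foot_has_derivative[of "snd x" "fst x"] by auto
  next
    fix v :: "real \<times> real"
    show "Ck_on k (\<lambda>x. (fst v + - snd v * w0 (foot (fst x) (snd x)))
        * inverse (1 + snd x * deriv w0 (foot (fst x) (snd x)))) (UNIV \<times> {0..<\<epsilon>})"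
      using jacobian_pos
      by (intro Ck_on_mult Ck_on_add Ck_on_inverse Ck_on_const Ck_on_bounded_linear bounded_linear_snd
          Ck_on_compose[OF w0 Suc.IH] Ck_on_compose[OF smooth_on_deriv(2)[OF smooth] Suc.IH])
        (auto simp: less_imp_neq[symmetric])
  qed
qed

lemma smooth_sol: "smooth_on (\<lambda>(\<theta>, t). sol \<theta> t) (UNIV \<times> {0..<\<epsilon>})"
  using smooth unfolding smooth_on_def sol_def case_prod_unfold
  by (auto intro: Ck_on_compose[OF _ Ck_on_foot])

lemma foot_DERIV:
  assumes t: "t \<in> {0..<\<epsilon>}"
  shows "((\<lambda>\<phi>. foot \<phi> t) has_real_derivative inverse (1 + t * deriv w0 (foot \<theta> t))) (at \<theta>)"
    and "((\<lambda>s. foot \<theta> s) has_real_derivative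
      - w0 (foot \<theta> t) * inverse (1 + t * deriv w0 (foot \<theta> t))) (at t within {0..<\<epsilon>})"
proof -
  let ?S = "UNIV \<times> {0..<\<epsilon>}"
  let ?f' = "\<lambda>x v. (fst v - snd v * w0 (foot (fst x) (snd x)))
      * inverse (1 + snd x * deriv w0 (foot (fst x) (snd x)))"
  have f': "((\<lambda>x. foot (fst x) (snd x)) has_derivative ?f' x) (at x within ?S)"
    if "x \<in> ?S" for x
    using foot_has_derivative[of "snd x" "fst x"] that by auto
  have 1: "((\<lambda>\<phi>. (\<phi>, t)) has_derivative (\<lambda>h. (h, 0))) (at \<theta>)"
    by (intro has_derivative_Pair has_derivative_ident has_derivative_const)
  have 2: "((\<lambda>s. (\<theta>, s)) has_derivative (\<lambda>h. (0, h))) (at t within {0..<\<epsilon>})"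
    by (intro has_derivative_Pair has_derivative_ident has_derivative_const)
  have neg: "(\<lambda>y. - (y * a)) = (*) (- a)" for a :: real
    by (simp add: fun_eq_iff)
  show "((\<lambda>\<phi>. foot \<phi> t) has_real_derivative inverse (1 + t * deriv w0 (foot \<theta> t))) (at \<theta>)"
    using has_derivative_in_compose2[OF f' _ _ 1] t
    by (simp add: has_field_derivative_def mult_commute_abs image_subset_iff)
  show "((\<lambda>s. foot \<theta> s) has_real_derivative
      - w0 (foot \<theta> t) * inverse (1 + t * deriv w0 (foot \<theta> t))) (at t within {0..<\<epsilon>})"
    using has_derivative_in_compose2[OF f' _ _ 2] t neg
    by (simp add: has_field_derivative_def image_subset_iff mult.assoc)
qed

lemma sol_DERIV:
  fixes \<theta> t :: real
  assumes t: "t \<in> {0..<\<epsilon>}"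
  defines "w\<theta> \<equiv> deriv w0 (foot \<theta> t) * inverse (1 + t * deriv w0 (foot \<theta> t))"
  shows "((\<lambda>\<phi>. sol \<phi> t) has_real_derivative w\<theta>) (at \<theta>)"
    and "((\<lambda>s. sol \<theta> s) has_real_derivative - sol \<theta> t * w\<theta>) (at t within {0..<\<epsilon>})"
  unfolding sol_def w\<theta>_def
  using DERIV_chain'[OF foot_DERIV(1)[OF t] DERIV_w0] DERIV_chain'[OF foot_DERIV(2)[OF t] DERIV_w0]
  by (auto simp: ac_simps)

lemma periodic_sol: "t \<in> {0..<\<epsilon>} \<Longrightarrow> periodic (\<lambda>\<theta>. sol \<theta> t)"
proof -
  assume t: "t \<in> {0..<\<epsilon>}"
  have w0: "w0 (y + 2 * pi) = w0 y" for y using periodic unfolding periodic_def by blast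
  have "foot (\<theta> + 2 * pi) t = foot \<theta> t + 2 * pi" for \<theta>
    using foot[OF t, of \<theta>] by (intro foot_unique[OF t]) (simp add: w0)
  then show ?thesis unfolding periodic_def sol_def by (simp add: w0)
qed

lemma sol_0: "sol \<theta> 0 = w0 \<theta>"
  using foot_unique[of 0 \<theta> \<theta>] \<epsilon> by (simp add: sol_def)

lemma burgers_solution_sol: "burgers_solution w0 \<epsilon> sol"
  unfolding burgers_solution_def
proof (intro conjI ballI allI)
  show "Ck_on 1 (\<lambda>(\<theta>, t). sol \<theta> t) (UNIV \<times> {0..<\<epsilon>})"
    using smooth_sol unfolding smooth_on_def by blast
  fix \<theta> t assume t: "t \<in> {0..<\<epsilon>}"
  show "time_deriv (\<lambda>s. sol \<theta> s) t + sol \<theta> t * deriv (\<lambda>\<phi>. sol \<phi> t) \<theta> = 0"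
    using time_deriv_eq[OF sol_DERIV(2)[OF t, of \<theta>] t] DERIV_imp_deriv[OF sol_DERIV(1)[OF t, of \<theta>]]
    by simp
qed (auto simp: periodic_sol sol_0)

text \<open>Along a characteristic of \<open>sol\<close>, the difference \<open>g\<close> to another solution satisfies a linear
  equation \<open>g' = - p g\<close>.\<close>

lemma burgers_unique:
  assumes w': "burgers_solution w0 \<epsilon> w'" and t: "t \<in> {0..<\<epsilon>}"
  shows "w' \<theta> t = sol \<theta> t"
proof -
  let ?S = "(UNIV :: real set) \<times> {0..<\<epsilon>}"
  define y where "y = foot \<theta> t"
  have "Ck_on 1 (\<lambda>(\<theta>, t). w' \<theta> t) ?S"
    using w' unfolding burgers_solution_def by blast
  then obtain F where F: "\<And>x. x \<in> ?S \<Longrightarrow> ((\<lambda>(\<theta>, t). w' \<theta> t) has_derivative F x) (at x within ?S)"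
      and cF: "\<And>v. continuous_on ?S (\<lambda>x. F x v)"
    by auto
  have F_lin: "F x (h, k) = h * F x (1, 0) + k * F x (0, 1)" if "x \<in> ?S" for x h k
  proof -
    have lin: "linear (F x)" using F[OF that] has_derivative_linear by blast
    have "F x (h, k) = F x (h *\<^sub>R (1, 0) + k *\<^sub>R (0, 1))" by simp
    then show ?thesis by (simp only: linear_add[OF lin] linear_cmul[OF lin]) simp
  qed
  have slice: "((\<lambda>s. w' (x s) (\<tau> s)) has_real_derivative F (x s, \<tau> s) (dx, d\<tau>)) (at s within A)"
    if "(x has_real_derivative dx) (at s within A)" "(\<tau> has_real_derivative d\<tau>) (at s within A)"
      "s \<in> A" "\<And>s. s \<in> A \<Longrightarrow> \<tau> s \<in> {0..<\<epsilon>}" for x \<tau> s dx d\<tau> A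
  proof -
    have p: "(x s, \<tau> s) \<in> ?S" using that by auto
    have "((\<lambda>s. (x s, \<tau> s)) has_derivative (\<lambda>h. (h * dx, h * d\<tau>))) (at s within A)"
      using that(1,2) by (auto intro!: has_derivative_Pair simp: has_field_derivative_def mult_commute_abs)
    from has_derivative_in_compose2[OF F _ _ this] that(3,4)
    have "((\<lambda>s. w' (x s) (\<tau> s)) has_derivative (\<lambda>h. F (x s, \<tau> s) (h * dx, h * d\<tau>))) (at s within A)"
      by (simp add: image_subset_iff)
    moreover have "(\<lambda>h. F (x s, \<tau> s) (h * dx, h * d\<tau>)) = (*) (F (x s, \<tau> s) (dx, d\<tau>))"
      by (rule ext, subst (1 2) F_lin[OF p]) (simp add: algebra_simps)
    ultimately show ?thesis by (simp add: has_field_derivative_def)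
  qed
  have eq: "F (x, s) (0, 1) = - w' x s * F (x, s) (1, 0)" if s: "s \<in> {0..<\<epsilon>}" for x s
  proof -
    have "((\<lambda>\<phi>. w' \<phi> s) has_real_derivative F (x, s) (1, 0)) (at x)"
      using slice[of "\<lambda>\<phi>. \<phi>" 1 x UNIV "\<lambda>\<phi>. s" 0] s by simp
    moreover have "((\<lambda>s. w' x s) has_real_derivative F (x, s) (0, 1)) (at s within {0..<\<epsilon>})"
      using slice[of "\<lambda>s. x" 0 s "{0..<\<epsilon>}" "\<lambda>s. s" 1] s by simp
    moreover have "time_deriv (\<lambda>s. w' x s) s + w' x s * deriv (\<lambda>\<phi>. w' \<phi> s) x = 0"
      using w' s unfolding burgers_solution_def by blast
    ultimately show ?thesis
      using time_deriv_eq[OF _ s] DERIV_imp_deriv by fastforce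
  qed
  \<comment> \<open>The characteristic of \<open>sol\<close> through the given point: it starts at
    \<open>y\<close> and reaches \<theta> at time \<open>t\<close>.\<close>
  define X where "X s = y + s * w0 y" for s
  define g where "g s = w' (X s) s - w0 y" for s
  define p where "p s = F (X s, s) (1, 0)" for s
  have Dg: "(g has_real_derivative - p s * g s) (at s within {0..t})" if "s \<in> {0..t}" for s
  proof -
    have s: "s \<in> {0..<\<epsilon>}" using that t by auto
    have "(X has_real_derivative w0 y) (at s within {0..t})"
      unfolding X_def by (auto intro!: derivative_eq_intros)
    then have "((\<lambda>s. w' (X s) s) has_real_derivative F (X s, s) (w0 y, 1)) (at s within {0..t})"
      using that t by (intro slice) auto
    then have "(g has_real_derivative F (X s, s) (w0 y, 1)) (at s within {0..t})"
      unfolding g_def by (auto intro!: derivative_eq_intros)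
    \<comment> \<open>The line moves with velocity \<open>w0 y\<close>, whereas the equation for
      \<open>w'\<close> transports with velocity \<open>w' (X s) s\<close>. The mismatch is
      \<open>g s\<close>, multiplied by the spatial slope \<open>p s\<close>.\<close>
    moreover have "F (X s, s) (w0 y, 1) = - p s * g s"
      using s F_lin[of "(X s, s)" "w0 y" 1] eq[OF s] by (simp add: p_def g_def algebra_simps)
    ultimately show ?thesis by simp
  qed
  have "continuous_on {0..t} p"
    unfolding p_def X_def
    by (rule continuous_on_compose2[OF cF]) (use t in \<open>auto intro!: continuous_intros\<close>)
  then have "bounded (p ` {0..t})"
    by (intro compact_imp_bounded compact_continuous_image) auto
  then obtain K where "\<forall>x\<in>p ` {0..t}. norm x \<le> K"
    unfolding bounded_iff by blast
  then have K: "\<And>s. s \<in> {0..t} \<Longrightarrow> \<bar>p s\<bar> \<le> K" by simp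
  \<comment> \<open>Squaring fixes the sign: from \<open>\<bar>p s\<bar> \<le> K\<close> the
    derivative of the square is at most \<open>2 * K\<close> times the square.\<close>
  have "(g t)\<^sup>2 \<le> 0"
  proof (rule gronwall_nonpos[of t "\<lambda>s. (g s)\<^sup>2" "\<lambda>s. 2 * g s * (- p s * g s)" "2 * K"])
    fix s assume s: "s \<in> {0..t}"
    show "((\<lambda>s. (g s)\<^sup>2) has_real_derivative 2 * g s * (- p s * g s)) (at s within {0..t})"
      using Dg[OF s] by (auto intro!: derivative_eq_intros)
    have "- p s * (g s)\<^sup>2 \<le> K * (g s)\<^sup>2"
      using K[OF s] by (intro mult_right_mono) auto
    then show "2 * g s * (- p s * g s) \<le> 2 * K * (g s)\<^sup>2"
      by (simp add: power2_eq_square algebra_simps)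
  next
    have "w' y 0 = w0 y" using w' unfolding burgers_solution_def by blast
    then show "(g 0)\<^sup>2 \<le> 0" by (simp add: g_def X_def)
  qed (use t in auto)
  then have "w' (X t) t = w0 y" by (simp add: g_def)
  moreover have "X t = \<theta>" unfolding X_def y_def by (rule foot[OF t])
  ultimately show ?thesis by (simp add: sol_def y_def)
qed

text \<open>At time \<epsilon> the flow map may be degenerate, but near \<open>\<theta>0\<close> its
  derivative vanishes only at \<open>\<theta>0\<close>, so it still separates nearby points from
  \<open>\<theta>0\<close>. A point \<open>z\<close> on one side of \<open>\<theta>0\<close> is thus
  carried strictly to that side of \<open>?\<theta>s\<close> at time \<epsilon>, hence also shortly
  before, and monotonicity at the earlier time places the foot on the other side of
  \<open>z\<close>.\<close>

lemma foot_tendsto: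
  assumes \<theta>0: "deriv w0 \<theta>0 = - (1 / \<epsilon>)"
    and isolated: "\<And>\<theta>. deriv w0 \<theta> = - (1 / \<epsilon>) \<Longrightarrow> \<bar>\<theta> - \<theta>0\<bar> < 1 \<Longrightarrow> \<theta> = \<theta>0"
  shows "((\<lambda>t. foot (\<theta>0 + \<epsilon> * w0 \<theta>0) t) \<longlongrightarrow> \<theta>0) (at_left \<epsilon>)"
proof (rule order_tendstoI)
  let ?\<theta>s = "\<theta>0 + \<epsilon> * w0 \<theta>0"
  have near: "\<forall>\<^sub>F t in at_left \<epsilon>. t \<in> {0..<\<epsilon>}"
    using eventually_at_left_real[OF \<epsilon>] by eventually_elim auto
  have lim: "((\<lambda>t. y + t * w0 y) \<longlongrightarrow> y + \<epsilon> * w0 y) (at_left \<epsilon>)" for y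
    by (auto intro!: tendsto_eq_intros)
  \<comment> \<open>The intermediate point lies strictly between \<open>z\<close> and
    \<open>y\<close>, one of which is \<open>\<theta>0\<close>; so it differs from
    \<open>\<theta>0\<close> and the slope there exceeds the minimum strictly.\<close>
  have mvt: "0 < (y - z) + \<epsilon> * (w0 y - w0 z)" if "z < y" "\<theta>0 - 1 < z" "y < \<theta>0 + 1" "\<theta>0 \<in> {z, y}" for y z
  proof -
    obtain x where x: "z < x" "x < y" "w0 y - w0 z = (y - z) * deriv w0 x"
      using MVT2[OF \<open>z < y\<close>, of w0 "deriv w0"] DERIV_w0 by blast
    have "x \<noteq> \<theta>0" "\<bar>x - \<theta>0\<bar> < 1" using x that by auto
    then have "deriv w0 x > - (1 / \<epsilon>)"
      using isolated[of x] deriv_ge[of x] by linarith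
    then have "0 < 1 + \<epsilon> * deriv w0 x"
      using \<epsilon> by (simp add: field_simps)
    then have "0 < (y - z) * (1 + \<epsilon> * deriv w0 x)" using that by simp
    then show ?thesis by (simp add: x(3) algebra_simps)
  qed
  show "\<forall>\<^sub>F t in at_left \<epsilon>. a < foot ?\<theta>s t" if "a < \<theta>0" for a
  proof -
    \<comment> \<open>The given \<open>a\<close> may be far away; this moves it into the window of
      radius 1 in which \<open>isolated\<close> applies.\<close>
    define z where "z = max a (\<theta>0 - 1 / 2)"
    have "z < \<theta>0" "\<theta>0 - 1 < z" "a \<le> z" using that by (auto simp: z_def)
    then have "z + \<epsilon> * w0 z < ?\<theta>s" using mvt[of z \<theta>0] by (simp add: algebra_simps)
    from order_tendstoD(2)[OF lim this] near show ?thesis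
    proof eventually_elim
      case (elim t)
      then show ?case
        using flow_strict_mono[OF elim(2), of "foot ?\<theta>s t" z] foot[OF elim(2), of ?\<theta>s] \<open>a \<le> z\<close>
        by (cases "foot ?\<theta>s t" z rule: linorder_cases) auto
    qed
  qed
  show "\<forall>\<^sub>F t in at_left \<epsilon>. foot ?\<theta>s t < a" if "\<theta>0 < a" for a
  proof -
    define z where "z = min a (\<theta>0 + 1 / 2)"
    have "\<theta>0 < z" "z < \<theta>0 + 1" "z \<le> a" using that by (auto simp: z_def)
    then have "?\<theta>s < z + \<epsilon> * w0 z" using mvt[of \<theta>0 z] by (simp add: algebra_simps)
    from order_tendstoD(1)[OF lim this] near show ?thesis
    proof eventually_elim
      case (elim t)
      then show ?case
        using flow_strict_mono[OF elim(2), of z "foot ?\<theta>s t"] foot[OF elim(2), of ?\<theta>s] \<open>z \<le> a\<close>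
        by (cases "foot ?\<theta>s t" z rule: linorder_cases) auto
    qed
  qed
qed

lemma sol_blowup:
  assumes \<theta>0: "deriv w0 \<theta>0 = - (1 / \<epsilon>)"
    and isolated: "\<And>\<theta>. deriv w0 \<theta> = - (1 / \<epsilon>) \<Longrightarrow> \<bar>\<theta> - \<theta>0\<bar> < 1 \<Longrightarrow> \<theta> = \<theta>0"
  shows "filterlim (\<lambda>t. deriv (\<lambda>\<theta>. sol \<theta> t) (\<theta>0 + \<epsilon> * w0 \<theta>0)) at_bot (at_left \<epsilon>)"
proof -
  let ?Y = "\<lambda>t. foot (\<theta>0 + \<epsilon> * w0 \<theta>0) t"
  have near: "\<forall>\<^sub>F t in at_left \<epsilon>. t \<in> {0..<\<epsilon>}"
    using eventually_at_left_real[OF \<epsilon>] by eventually_elim auto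
  have "continuous_on UNIV (deriv w0)"
    using smooth_on_deriv(2)[OF smooth, of 0] by simp
  then have "isCont (deriv w0) \<theta>0"
    by (simp add: continuous_on_eq_continuous_at)
  from isCont_tendsto_compose[OF this foot_tendsto[OF \<theta>0 isolated]]
  have D: "((\<lambda>t. deriv w0 (?Y t)) \<longlongrightarrow> - (1 / \<epsilon>)) (at_left \<epsilon>)"
    by (simp only: \<theta>0)
  then have "((\<lambda>t. 1 + t * deriv w0 (?Y t)) \<longlongrightarrow> 0) (at_left \<epsilon>)"
    using \<epsilon> by (auto intro!: tendsto_eq_intros)
  \<comment> \<open>The denominator approaches zero from above, and the numerator tends to the
    negative number \<open>- (1 / \<epsilon>)\<close>; together they fix the sign of the
    blow-up.\<close>
  moreover have "\<forall>\<^sub>F t in at_left \<epsilon>. 0 < 1 + t * deriv w0 (?Y t)"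
    using near by eventually_elim (rule jacobian_pos)
  ultimately have "filterlim (\<lambda>t. inverse (1 + t * deriv w0 (?Y t))) at_top (at_left \<epsilon>)"
    by (rule filterlim_inverse_at_top)
  then have "filterlim (\<lambda>t. deriv w0 (?Y t) * inverse (1 + t * deriv w0 (?Y t))) at_bot (at_left \<epsilon>)"
    using D \<epsilon> by (intro filterlim_tendsto_neg_mult_at_bot) auto
  moreover have "\<forall>\<^sub>F t in at_left \<epsilon>. deriv w0 (?Y t) * inverse (1 + t * deriv w0 (?Y t))
      = deriv (\<lambda>\<theta>. sol \<theta> t) (\<theta>0 + \<epsilon> * w0 \<theta>0)"
    using near by eventually_elim (use sol_DERIV(1) DERIV_imp_deriv in metis)
  ultimately show ?thesis
    by (rule filterlim_cong[OF refl refl, THEN iffD1, rotated])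
qed

end

section \<open>The Burgers solution as an Euler flow\<close>

lemma Linf_norm_le:
  assumes "continuous_on S f" "\<And>x. x \<in> S \<Longrightarrow> norm (f x) \<le> c"
  shows "Linf_norm S f \<le> ereal c"
  unfolding Linf_norm_def
proof (rule esssup_I)
  have "(\<lambda>x. ereal (norm (f x))) \<in> borel_measurable (restrict_space borel S)"
    using assms(1) by (intro borel_measurable_continuous_on_restrict continuous_intros)
  then show "(\<lambda>x. ereal (norm (f x))) \<in> borel_measurable (restrict_space lborel S)"
    by (simp add: measurable_cong_sets[OF sets_restrict_space_cong[OF sets_lborel] refl])
  show "AE x in restrict_space lborel S. ereal (norm (f x)) \<le> ereal c"
    using assms(2) by (intro AE_I2) (auto simp: space_restrict_space)
qed

text \<open>The set where \<open>\<bar>f x\<bar> \<le> c\<close> is closed and contains almost every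
  point of the open interval, hence every point of it; the endpoints follow by continuity. This
  makes the norm hypothesis on \<open>w0\<close> usable pointwise.\<close>

lemma norm_le_Linf_norm_interval:
  fixes f :: "real \<Rightarrow> real"
  assumes "continuous_on UNIV f" "Linf_norm {a..b} f \<le> ereal c" "a < b" "x \<in> {a..b}"
  shows "\<bar>f x\<bar> \<le> c"
proof -
  let ?C = "{x. \<bar>f x\<bar> \<le> c}"
  have "AE x in restrict_space lborel {a..b}. ereal (norm (f x)) \<le> Linf_norm {a..b} f"
    unfolding Linf_norm_def by (rule esssup_AE)
  then have "AE x in restrict_space lborel {a..b}. \<bar>f x\<bar> \<le> c"
    by eventually_elim (use assms(2) order_trans in fastforce)
  then have "AE x in lborel. x \<in> {a..b} \<longrightarrow> \<bar>f x\<bar> \<le> c"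
    by (subst (asm) AE_restrict_space_iff) auto
  then have ae: "AE x\<in>{a<..<b} in lebesgue. x \<in> ?C"
    by (intro AE_completion) (auto elim!: eventually_mono)
  have "closed ?C"
    using assms(1) by (intro closed_Collect_le continuous_intros)
  then have "\<bar>f x\<bar> \<le> c" if "x \<in> {a<..<b}" for x
    using mem_closed_if_AE_lebesgue_open[OF _ _ ae that] by simp
  then show ?thesis
    using continuous_le_on_closure[of "{a<..<b}" "\<lambda>x. \<bar>f x\<bar>" x c] assms
    by (auto intro!: continuous_intros continuous_on_subset[OF assms(1)])
qed

lemma periodic_reduce:
  assumes "periodic f"
  obtains x where "x \<in> {- pi..pi}" "f x = f \<theta>"
proof -
  interpret periodic_fun_simple f "2 * pi"
    by unfold_locales (use assms in \<open>auto simp: periodic_def\<close>)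
  \<comment> \<open>Removing the multiple of \<open>2 * pi\<close> nearest to \<theta> leaves at
    most \<open>pi\<close> in absolute value.\<close>
  define n where "n = round (\<theta> / (2 * pi))"
  have "\<bar>of_int n - \<theta> / (2 * pi)\<bar> \<le> 1 / 2"
    unfolding n_def by (rule of_int_round_abs_le)
  then have "\<bar>of_int n - \<theta> / (2 * pi)\<bar> * (2 * pi) \<le> 1 / 2 * (2 * pi)"
    by (intro mult_right_mono) auto
  also have "\<bar>of_int n - \<theta> / (2 * pi)\<bar> * (2 * pi) = \<bar>(of_int n - \<theta> / (2 * pi)) * (2 * pi)\<bar>"
    by (simp add: abs_mult)
  also have "(of_int n - \<theta> / (2 * pi)) * (2 * pi) = of_int n * (2 * pi) - \<theta>"
    by (simp add: left_diff_distrib)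
  finally have "\<theta> - of_int n * (2 * pi) \<in> {- pi..pi}" by auto
  moreover have "f (\<theta> - of_int n * (2 * pi)) = f \<theta>" by (rule minus_of_int)
  ultimately show ?thesis using that by blast
qed

section \<open>The flow built from the Burgers solution\<close>

context burgers_data
begin

text \<open>A single field plays both roles, angular velocity and density.\<close>

definition sol_field :: field where
  "sol_field r \<theta> t = 1 / 2 * r * sol \<theta> t"

lemma d_r_sol_field: "d_r sol_field r \<theta> t = sol \<theta> t / 2"
proof -
  have "((\<lambda>s. sol_field s \<theta> t) has_real_derivative sol \<theta> t / 2) (at r)"
    unfolding sol_field_def by (auto intro!: derivative_eq_intros)
  then show ?thesis unfolding d_r_def by (rule DERIV_imp_deriv)
qed

lemma d_theta_sol_field:
  assumes "t \<in> {0..<\<epsilon>}"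
  shows "d_theta sol_field r \<theta> t = 1 / 2 * r * deriv (\<lambda>\<phi>. sol \<phi> t) \<theta>"
  unfolding d_theta_def sol_field_def
    DERIV_imp_deriv[OF DERIV_cmult[OF sol_DERIV(1)[OF assms, of \<theta>], of "1 / 2 * r"]]
    DERIV_imp_deriv[OF sol_DERIV(1)[OF assms, of \<theta>]] ..

lemma d_t_sol_field:
  assumes "t \<in> {0..<\<epsilon>}"
  shows "d_t sol_field r \<theta> t = - (1 / 2 * r * sol \<theta> t * deriv (\<lambda>\<phi>. sol \<phi> t) \<theta>)"
  unfolding d_t_def sol_field_def
    time_deriv_eq[OF DERIV_cmult[OF sol_DERIV(2)[OF assms, of \<theta>], of "1 / 2 * r"] assms]
    DERIV_imp_deriv[OF sol_DERIV(1)[OF assms, of \<theta>]] by simp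

text \<open>Angular transport contributes a quarter of \<open>r\<close> times \<open>sol\<close>
  times its angular slope. The pressure term in the angular equation, and the compression term in
  the density equation, contribute the same again. The factor \<open>1 / 2\<close> in
  \<open>sol_field\<close> is what makes the two add up to the Burgers nonlinearity. In the radial
  equation the centrifugal term is balanced by the pressure gradient.\<close>

lemma euler_equations_sol_field:
  assumes "0 < r" "t \<in> {0..<\<epsilon>}" "0 < sol \<theta> t"
  shows "euler_equations_at 3 (\<lambda>r \<theta> t. 0) sol_field sol_field r \<theta> t"
proof -
  have 0: "d_r (\<lambda>r \<theta> t. 0) r \<theta> t = 0" "d_theta (\<lambda>r \<theta> t. 0) r \<theta> t = 0"
    by (simp_all add: d_r_def d_theta_def)
  have 1: "d_t (\<lambda>r \<theta> t. 0) r \<theta> t = 0"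
    unfolding d_t_def by (rule time_deriv_eq[OF DERIV_const assms(2)])
  have 2: "sol_field r \<theta> t powr (3 - 2) = sol_field r \<theta> t"
    using assms by (simp add: sol_field_def)
  show ?thesis
    unfolding euler_equations_at_def material_deriv_def 0 1 2 d_r_sol_field
      d_theta_sol_field[OF assms(2)] d_t_sol_field[OF assms(2)]
    using assms(1) by (simp add: sol_field_def power2_eq_square)
qed

lemma smooth_sol_field: "smooth_field r0 r1 \<epsilon> sol_field"
proof -
  have "Ck_on k (\<lambda>x. 1 / 2 * fst x * (\<lambda>(\<theta>, t). sol \<theta> t) (snd x)) ({r0..r1} \<times> UNIV \<times> {0..<\<epsilon>})"
    for k
    using smooth_sol unfolding smooth_on_def
    by (intro Ck_on_mult[OF Ck_on_mult[OF Ck_on_const Ck_on_bounded_linear[OF bounded_linear_fst]]]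
        Ck_on_compose_linear[OF bounded_linear_snd, where T = "UNIV \<times> {0..<\<epsilon>}"]) auto
  moreover have "periodic (\<lambda>\<theta>. sol_field r \<theta> t)" if "t \<in> {0..<\<epsilon>}" for r t
    using periodic_sol[OF that] by (simp add: periodic_def sol_field_def)
  ultimately show ?thesis
    unfolding smooth_field_def smooth_on_def by (simp add: sol_field_def case_prod_unfold)
qed

lemma euler_solution_sol_field:
  assumes "0 < r0" "\<And>\<theta>. 0 < w0 \<theta>"
  shows "euler_solution 3 r0 r1 \<epsilon> (\<lambda>r \<theta>. 0) (\<lambda>r \<theta>. 1 / 2 * r * w0 \<theta>) (\<lambda>r \<theta>. 1 / 2 * r * w0 \<theta>)
    (\<lambda>r \<theta> t. 0) sol_field sol_field"
proof -
  have "smooth_field r0 r1 \<epsilon> (\<lambda>r \<theta> t. 0)"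
    by (simp add: smooth_field_def smooth_on_def case_prod_unfold Ck_on_const periodic_def)
  moreover have "0 < sol \<theta> t" for \<theta> t using assms(2) by (simp add: sol_def)
  ultimately show ?thesis
    unfolding euler_solution_def using assms(1)
    by (auto intro!: smooth_sol_field euler_equations_sol_field simp: sol_0)
      (auto simp: sol_field_def sol_0)
qed

lemma continuous_on_sol: "t \<in> {0..<\<epsilon>} \<Longrightarrow> continuous_on A (\<lambda>\<theta>. sol \<theta> t)"
  by (rule DERIV_continuous_on, rule has_field_derivative_at_within, rule sol_DERIV(1))

text \<open>All values of \<open>sol\<close> are values of \<open>w0\<close>, so they are at most 1
  in absolute value. The zero radial component leaves the norm of the velocity equal to that of its
  angular component, so density and velocity each account for half of the bound claimed for their
  sum.\<close>

lemma Linf_sol_field: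
  assumes "0 < r0" "r0 < r1" "\<And>\<theta>. \<bar>w0 \<theta>\<bar> \<le> 1" and t: "t \<in> {0..<\<epsilon>}"
  shows "Linf_norm (annulus r0 r1) (\<lambda>(r, \<theta>). sol_field r \<theta> t) \<le> ereal r1"
    and "Linf_norm (annulus r0 r1) (\<lambda>(r, \<theta>). (0 :: real, sol_field r \<theta> t)) \<le> ereal r1"
    and "Linf_norm (annulus r0 r1) (\<lambda>(r, \<theta>). d_r sol_field r \<theta> t) \<le> ereal 1"
    and "Linf_norm (annulus r0 r1) (\<lambda>(r, \<theta>). (0 :: real, d_r sol_field r \<theta> t)) \<le> ereal 1"
proof -
  have w: "\<bar>sol \<theta> t\<bar> \<le> 1" for \<theta> using assms(3) by (simp add: sol_def)
  have cont: "continuous_on (annulus r0 r1) (\<lambda>x. sol (snd x) t)"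
    by (rule continuous_on_compose2[OF continuous_on_sol[OF t, of UNIV]])
      (auto intro: continuous_intros)
  have le: "\<bar>1 / 2 * r * sol \<theta> t\<bar> \<le> r1" if "r0 < r" "r < r1" for r \<theta>
  proof -
    have "\<bar>1 / 2 * r * sol \<theta> t\<bar> = (1 / 2 * r) * \<bar>sol \<theta> t\<bar>"
      using that assms(1) by (simp add: abs_mult)
    also have "\<dots> \<le> (1 / 2 * r) * 1"
      using that assms(1) w by (intro mult_left_mono) auto
    finally show ?thesis using that assms(1) by simp
  qed
  have le': "\<bar>sol \<theta> t / 2\<bar> \<le> 1" for \<theta> using w[of \<theta>] by simp
  show "Linf_norm (annulus r0 r1) (\<lambda>(r, \<theta>). sol_field r \<theta> t) \<le> ereal r1"
    unfolding sol_field_def case_prod_unfold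
  proof (rule Linf_norm_le, goal_cases)
    case 1
    show ?case by (intro continuous_intros cont) simp_all
  next
    case (2 x)
    then show ?case
      using le by (auto simp: annulus_def norm_Pair simp del: abs_divide)
  qed
  show "Linf_norm (annulus r0 r1) (\<lambda>(r, \<theta>). (0 :: real, sol_field r \<theta> t)) \<le> ereal r1"
    unfolding sol_field_def case_prod_unfold
  proof (rule Linf_norm_le, goal_cases)
    case 1
    show ?case by (intro continuous_intros cont) simp_all
  next
    case (2 x)
    then show ?case
      using le by (auto simp: annulus_def norm_Pair simp del: abs_divide)
  qed
  show "Linf_norm (annulus r0 r1) (\<lambda>(r, \<theta>). d_r sol_field r \<theta> t) \<le> ereal 1"
    unfolding d_r_sol_field case_prod_unfold
  proof (rule Linf_norm_le, goal_cases)
    case 1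
    show ?case by (intro continuous_intros cont) simp_all
  next
    case (2 x)
    then show ?case
      using le' by (auto simp: annulus_def norm_Pair simp del: abs_divide)
  qed
  show "Linf_norm (annulus r0 r1) (\<lambda>(r, \<theta>). (0 :: real, d_r sol_field r \<theta> t)) \<le> ereal 1"
    unfolding d_r_sol_field case_prod_unfold
  proof (rule Linf_norm_le, goal_cases)
    case 1
    show ?case by (intro continuous_intros cont) simp_all
  next
    case (2 x)
    then show ?case
      using le' by (auto simp: annulus_def norm_Pair simp del: abs_divide)
  qed
qed

lemma vorticity_sol_field:
  assumes "0 < r"
  shows "vorticity (\<lambda>r \<theta> t. 0) sol_field r \<theta> t = sol \<theta> t"
proof -
  have "((\<lambda>s. s * sol_field s \<theta> t) has_real_derivative r * sol \<theta> t) (at r)"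
    unfolding sol_field_def by (auto intro!: derivative_eq_intros)
  then have "d_r (\<lambda>s \<phi> \<tau>. s * sol_field s \<phi> \<tau>) r \<theta> t = r * sol \<theta> t"
    unfolding d_r_def by (rule DERIV_imp_deriv)
  then show ?thesis using assms by (simp add: vorticity_def d_theta_def)
qed

lemma d_theta_sol_field_blowup:
  assumes "deriv w0 \<theta>0 = - (1 / \<epsilon>)"
    and "\<And>\<theta>. deriv w0 \<theta> = - (1 / \<epsilon>) \<Longrightarrow> \<bar>\<theta> - \<theta>0\<bar> < 1 \<Longrightarrow> \<theta> = \<theta>0" and "0 < r"
  shows "filterlim (\<lambda>t. d_theta sol_field r (\<theta>0 + \<epsilon> * w0 \<theta>0) t) at_bot (at_left \<epsilon>)"
proof -
  have "filterlim (\<lambda>t. 1 / 2 * r * deriv (\<lambda>\<theta>. sol \<theta> t) (\<theta>0 + \<epsilon> * w0 \<theta>0)) at_bot (at_left \<epsilon>)"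
    using sol_blowup[OF assms(1,2)] assms(3)
    by (intro filterlim_tendsto_pos_mult_at_bot[OF tendsto_const]) auto
  moreover have "\<forall>\<^sub>F t in at_left \<epsilon>. 1 / 2 * r * deriv (\<lambda>\<theta>. sol \<theta> t) (\<theta>0 + \<epsilon> * w0 \<theta>0)
      = d_theta sol_field r (\<theta>0 + \<epsilon> * w0 \<theta>0) t"
    using eventually_at_left_real[OF \<epsilon>] by eventually_elim (simp add: d_theta_sol_field)
  ultimately show ?thesis
    by (rule filterlim_cong[OF refl refl, THEN iffD1, rotated])
qed

end

theorem theorem3p1:
  fixes r0 r1 \<nu>0 \<epsilon> \<theta>0 :: real and w0 :: "real \<Rightarrow> real"
  assumes "0 < r0" and "r0 < r1"
    and "periodic w0" and "smooth_on w0 UNIV"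
    and "0 < \<nu>0" and "\<forall>\<theta>. \<nu>0 \<le> w0 \<theta>"
    and "Linf_norm {-pi..pi} w0 \<le> 1"
    and "\<forall>\<theta>. deriv w0 \<theta>0 \<le> deriv w0 \<theta>"
    and "\<forall>\<theta>. deriv w0 \<theta> = deriv w0 \<theta>0 \<longrightarrow> [\<theta> = \<theta>0] (rmod (2 * pi))"
    and "0 < \<epsilon>" and "deriv w0 \<theta>0 = - (1 / \<epsilon>)"
  shows "\<exists>w. burgers_solution w0 \<epsilon> w \<and>
    (\<forall>w'. burgers_solution w0 \<epsilon> w' \<longrightarrow> (\<forall>\<theta>. \<forall>t\<in>{0..<\<epsilon>}. w' \<theta> t = w \<theta> t)) \<and>
    develops_singularity w \<epsilon> (\<theta>0 + \<epsilon> * w0 \<theta>0) \<and>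
    (let
       \<theta>s = \<theta>0 + \<epsilon> * w0 \<theta>0;
       ur = (\<lambda>r \<theta> t. 0);
       ut = (\<lambda>r \<theta> t. 1 / 2 * r * w \<theta> t);
       \<rho> = (\<lambda>r \<theta> t. 1 / 2 * r * w \<theta> t);
       is_sol = euler_solution 3 r0 r1 \<epsilon> (\<lambda>r \<theta>. 0)
                  (\<lambda>r \<theta>. 1 / 2 * r * w0 \<theta>) (\<lambda>r \<theta>. 1 / 2 * r * w0 \<theta>)
     in
       is_sol ur ut \<rho> \<and>
       (\<forall>ur' ut' \<rho>'. is_sol ur' ut' \<rho>' \<longrightarrow>
          (\<forall>r\<in>{r0..r1}. \<forall>\<theta>. \<forall>t\<in>{0..<\<epsilon>}.
             ur' r \<theta> t = ur r \<theta> t \<and> ut' r \<theta> t = ut r \<theta> t \<and> \<rho>' r \<theta> t = \<rho> r \<theta> t)) \<and>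
       (SUP t\<in>{0..<\<epsilon>}.
          Linf_norm (annulus r0 r1) (\<lambda>(r, \<theta>). \<rho> r \<theta> t) +
          Linf_norm (annulus r0 r1) (\<lambda>(r, \<theta>). (ur r \<theta> t, ut r \<theta> t))) \<le> ereal (2 * r1) \<and>
       (SUP t\<in>{0..<\<epsilon>}.
          Linf_norm (annulus r0 r1) (\<lambda>(r, \<theta>). d_r \<rho> r \<theta> t) +
          Linf_norm (annulus r0 r1) (\<lambda>(r, \<theta>). (d_r ur r \<theta> t, d_r ut r \<theta> t))) \<le> 2 \<and>
       (\<forall>r\<in>{r0<..<r1}.
          filterlim (\<lambda>t. d_theta \<rho> r \<theta>s t) at_bot (at_left \<epsilon>) \<and>
          filterlim (\<lambda>t. d_theta ut r \<theta>s t) at_bot (at_left \<epsilon>)) \<and>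
       (\<exists>\<omega>. \<forall>\<theta>. \<forall>t\<in>{0..<\<epsilon>}.
          \<nu>0 \<le> \<omega> \<theta> t \<and> \<omega> \<theta> t \<le> 1 \<and>
          (\<forall>r\<in>{r0<..<r1}. vorticity ur ut r \<theta> t = \<omega> \<theta> t \<and> \<rho> r \<theta> t \<ge> r0 * (\<nu>0 / 2))))"
proof -
  interpret burgers_data w0 \<epsilon>
    using assms by unfold_locales auto
  have le1: "\<bar>w0 \<theta>\<bar> \<le> 1" for \<theta>
  proof -
    obtain x where x: "x \<in> {- pi..pi}" "w0 x = w0 \<theta>"
      using periodic_reduce[OF assms(3)] by blast
    have "\<bar>w0 x\<bar> \<le> 1"
      by (rule norm_le_Linf_norm_interval[OF continuous_w0 _ _ x(1)])
        (use assms(7) in \<open>simp_all add: one_ereal_def\<close>)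
    then show ?thesis using x(2) by simp
  qed
  have pos: "0 < w0 \<theta>" for \<theta> using assms(5,6) less_le_trans by blast
  \<comment> \<open>The minimum point is unique modulo \<open>2 * pi\<close> only; distance less
    than 1, which is shorter than a period, singles out one representative.\<close>
  have isolated: "\<theta> = \<theta>0" if "deriv w0 \<theta> = - (1 / \<epsilon>)" "\<bar>\<theta> - \<theta>0\<bar> < 1" for \<theta>
  proof -
    have "[\<theta> = \<theta>0] (rmod (2 * pi))" using assms(9,11) that(1) by simp
    then obtain n :: int where n: "\<theta>0 = \<theta> + of_int n * (2 * pi)"
      unfolding rcong_altdef by blast
    then have "\<bar>real_of_int n\<bar> * (2 * pi) < 1"
      using that(2) by (simp add: abs_mult)
    moreover have "1 < 2 * pi" using pi_gt3 by simp
    ultimately have "\<bar>real_of_int n\<bar> < 1"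
      using mult_left_mono[of 1 "2 * pi" "\<bar>real_of_int n\<bar>"] by linarith
    then show ?thesis using n by simp
  qed
  have f: "sol_field = (\<lambda>r \<theta> t. 1 / 2 * r * sol \<theta> t)"
    by (simp add: sol_field_def fun_eq_iff)
  note euler = euler_solution_sol_field[OF assms(1) pos, of r1]
  have unique: "\<forall>ur' ut' \<rho>'. euler_solution 3 r0 r1 \<epsilon> (\<lambda>r \<theta>. 0) (\<lambda>r \<theta>. 1 / 2 * r * w0 \<theta>)
      (\<lambda>r \<theta>. 1 / 2 * r * w0 \<theta>) ur' ut' \<rho>' \<longrightarrow>
      (\<forall>r\<in>{r0..r1}. \<forall>\<theta>. \<forall>t\<in>{0..<\<epsilon>}. ur' r \<theta> t = 0 \<and> ut' r \<theta> t = sol_field r \<theta> t \<and>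
        \<rho>' r \<theta> t = sol_field r \<theta> t)"
    using euler_solution_3_unique[OF euler _ assms(1,2)] by blast
  \<comment> \<open>The solution takes only values of \<open>w0\<close>, so its bounds are those of
    the initial data at every time.\<close>
  have bounds: "\<nu>0 \<le> sol \<theta> t" "sol \<theta> t \<le> 1" for \<theta> t
    using assms(6) le1 abs_le_D1 by (auto simp: sol_def)
  have \<rho>_ge: "r0 * (\<nu>0 / 2) \<le> sol_field r \<theta> t" if "r0 < r" for r \<theta> t
  proof -
    have "r0 * \<nu>0 \<le> r * sol \<theta> t"
      using that assms(1,5) bounds(1)[of \<theta> t] by (intro mult_mono) auto
    then show ?thesis by (simp add: sol_field_def)
  qed
  have Dr0: "d_r (\<lambda>r \<theta> t. 0) r \<theta> t = 0" for r \<theta> t by (simp add: d_r_def)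
  note Linf = Linf_sol_field[OF assms(1,2) le1]
  have sup: "(SUP t\<in>{0..<\<epsilon>}. Linf_norm (annulus r0 r1) (\<lambda>(r, \<theta>). sol_field r \<theta> t) +
      Linf_norm (annulus r0 r1) (\<lambda>(r, \<theta>). (0 :: real, sol_field r \<theta> t))) \<le> ereal (2 * r1)"
    using add_mono[OF Linf(1,2)] by (intro SUP_least) simp
  have dsup: "(SUP t\<in>{0..<\<epsilon>}. Linf_norm (annulus r0 r1) (\<lambda>(r, \<theta>). d_r sol_field r \<theta> t) +
      Linf_norm (annulus r0 r1) (\<lambda>(r, \<theta>). (d_r (\<lambda>r \<theta> t. 0) r \<theta> t, d_r sol_field r \<theta> t))) \<le> 2"
    unfolding Dr0 using add_mono[OF Linf(3,4)] by (intro SUP_least) simp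
  have vort: "\<exists>\<omega>. \<forall>\<theta>. \<forall>t\<in>{0..<\<epsilon>}. \<nu>0 \<le> \<omega> \<theta> t \<and> \<omega> \<theta> t \<le> 1 \<and>
      (\<forall>r\<in>{r0<..<r1}. vorticity (\<lambda>r \<theta> t. 0) sol_field r \<theta> t = \<omega> \<theta> t \<and>
        r0 * (\<nu>0 / 2) \<le> sol_field r \<theta> t)"
    by (rule exI[of _ sol]) (use assms(1) bounds \<rho>_ge in \<open>auto intro!: vorticity_sol_field\<close>)
  have blowup: "filterlim (\<lambda>t. d_theta sol_field r (\<theta>0 + \<epsilon> * w0 \<theta>0) t) at_bot (at_left \<epsilon>)"
    if "r \<in> {r0<..<r1}" for r
    using that assms(1) by (intro d_theta_sol_field_blowup[OF assms(11) isolated]) auto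
  have sing: "develops_singularity sol \<epsilon> (\<theta>0 + \<epsilon> * w0 \<theta>0)"
    unfolding develops_singularity_def
    using smooth_sol periodic_sol sol_blowup[OF assms(11) isolated] by blast
  have bunique: "\<forall>w'. burgers_solution w0 \<epsilon> w' \<longrightarrow> (\<forall>\<theta>. \<forall>t\<in>{0..<\<epsilon>}. w' \<theta> t = sol \<theta> t)"
    using burgers_unique by blast
  have blowups: "\<forall>r\<in>{r0<..<r1}.
      filterlim (\<lambda>t. d_theta sol_field r (\<theta>0 + \<epsilon> * w0 \<theta>0) t) at_bot (at_left \<epsilon>) \<and>
      filterlim (\<lambda>t. d_theta sol_field r (\<theta>0 + \<epsilon> * w0 \<theta>0) t) at_bot (at_left \<epsilon>)"
    using blowup by blast
  show ?thesis
    unfolding Let_def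
    by (rule exI[of _ sol], intro conjI)
      (rule burgers_solution_sol bunique sing euler[unfolded f] unique[unfolded f] sup[unfolded f]
        dsup[unfolded f] blowups[unfolded f] vort[unfolded f])+
qed

end
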